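(* Fix the dimension $d$ as a constant. Given a convex polytope $\Omega \subset \mathbb{R}^d$ (with nonempty interior) and $\varepsilon > 0$, there exists a data structure that, for any query point $x \in \Omega$, returns a value $\widetilde{d}(x)$ with $|\widetilde{d}(x) - d_{\Omega}(x)| \leq \varepsilon \cdot \mathrm{diam}(\Omega)$ (with no continuity guarantee on $\widetilde{d}$), with query time $O(\log(1/\varepsilon))$ and storage $O(1/\varepsilon^{d/2})$.
   Context: $d_{\Omega}(x) = \inf_{y \in \partial\Omega}\|x - y\|$ is the Euclidean distance from $x \in \Omega$ to the boundary $\partial\Omega$, and $\mathrm{diam}(\Omega)$ is the diameter of $\Omega$. The hidden constants in the $O$-notation depend only on $d$. *)

theory Defs
  imports "HOL-Analysis.Analysis"
begin

text \<open>A minimal real-RAM model for the query algorithm.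
  Registers: nat => real. The data structure is a read-only real array D.
  Input point x is given in registers 0..DIM-1 as coordinates w.r.t. a fixed
  ordering of the standard basis. Each instruction costs one time unit.\<close>

datatype instr =
    Cst nat real
  | Add nat nat nat
  | Sub nat nat nat
  | Mul nat nat nat
  | Dv nat nat nat
  | Sqr nat nat
  | Ld nat nat
  | Jle nat nat nat
  | Jmp nat
  | Halt nat

type_synonym rstate = "nat \<times> (nat \<Rightarrow> real)"

definition load :: "real list \<Rightarrow> real \<Rightarrow> real" where
  "load D a = (if 0 \<le> a \<and> nat \<lfloor>a\<rfloor> < length D then D ! nat \<lfloor>a\<rfloor> else 0)"

fun exec_instr :: "real list \<Rightarrow> instr \<Rightarrow> rstate \<Rightarrow> rstate" where
  "exec_instr D (Cst i c) (pc, r) = (Suc pc, r(i := c))"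
| "exec_instr D (Add i j k) (pc, r) = (Suc pc, r(i := r j + r k))"
| "exec_instr D (Sub i j k) (pc, r) = (Suc pc, r(i := r j - r k))"
| "exec_instr D (Mul i j k) (pc, r) = (Suc pc, r(i := r j * r k))"
| "exec_instr D (Dv i j k) (pc, r) = (Suc pc, r(i := r j / r k))"
| "exec_instr D (Sqr i j) (pc, r) = (Suc pc, r(i := sqrt (r j)))"
| "exec_instr D (Ld i j) (pc, r) = (Suc pc, r(i := load D (r j)))"
| "exec_instr D (Jle i j k) (pc, r) = ((if r i \<le> r j then k else Suc pc), r)"
| "exec_instr D (Jmp k) (pc, r) = (k, r)"
| "exec_instr D (Halt i) (pc, r) = (pc, r)"

definition step :: "instr list \<Rightarrow> real list \<Rightarrow> rstate \<Rightarrow> rstate" where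
  "step P D s = (if fst s < length P then exec_instr D (P ! fst s) s else s)"

definition run :: "instr list \<Rightarrow> real list \<Rightarrow> rstate \<Rightarrow> nat \<Rightarrow> rstate" where
  "run P D s t = (step P D ^^ t) s"

definition basis_list :: "'a::euclidean_space list" where
  "basis_list = (SOME l. distinct l \<and> set l = Basis)"

definition init_regs :: "'a::euclidean_space \<Rightarrow> nat \<Rightarrow> real" where
  "init_regs x i = (if i < DIM('a) then x \<bullet> (basis_list ! i) else 0)"

definition halts_with ::
  "instr list \<Rightarrow> real list \<Rightarrow> 'a::euclidean_space \<Rightarrow> nat \<Rightarrow> real \<Rightarrow> bool" where
  "halts_with P D x t y =
     (let (pc, r) = run P D (0, init_regs x) t in
        pc < length P \<and> (\<exists>k. P ! pc = Halt k \<and> y = r k))"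

definition bdist :: "'a::euclidean_space set \<Rightarrow> 'a \<Rightarrow> real" where
  "bdist \<Omega> x = infdist x (frontier \<Omega>)"

end

theory Submission
  imports Defs "Jordan_Normal_Form.Determinant"
begin

text \<open>Scale \<open>\<Omega>\<close> to diameter 1. The distance function \<open>e\<close> to the boundary is 1-Lipschitz and has a
  unit supergradient at every point, so \<open>F y = |y|\<^sup>2 / 2 - e y\<close> is strongly convex, and its conjugate
  \<open>q\<close> is differentiable with 1-Lipschitz gradient. Hence \<open>F y\<close> is the maximum over \<open>p\<close> of the concave
  function \<open>p \<bullet> y - q p\<close>, attained at some \<open>p'\<close> with \<open>|p'| \<le> 2\<close>, and every \<open>p\<close> within \<open>\<rho>\<close> of \<open>p'\<close>
  is optimal up to \<open>\<rho>\<^sup>2 / 2\<close>. With \<open>\<rho>\<^sup>2 \<le> \<epsilon>\<close> it is therefore enough to tabulate \<open>q\<close> and its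
  gradient on a grid of mesh proportional to \<open>\<rho>\<close>, which takes \<open>O(\<epsilon> powr (- d / 2))\<close> numbers.

  A query maximises the concave function by a cutting-plane method with simplices (Yamnitsky and Levin),
  rounding the centroid to the grid. As long as no grid point with value at least \<open>F y - \<rho>\<^sup>2 / 2\<close> has
  been met, the cuts, which are exact at grid points, keep the ball of radius \<open>\<rho>\<close> about \<open>p'\<close>. A simplex
  containing this ball has width at least \<open>2 * \<rho>\<close> in every direction, so the rounding is
  harmless: each cut reduces the volume by a constant factor, and \<open>O(ln (1 / \<epsilon>))\<close> cuts suffice.\<close>

text \<open>A table of the distance itself needs mesh of order \<epsilon>, because the error of a
  Lipschitz function is linear in the mesh; that costs about 1/\<epsilon>^d entries. Adding the
  quadratic moves the table to the dual variable, where the loss at a wrong \<open>p\<close> is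
  quadratic in its distance to the optimal \<open>p'\<close>, and the exponent is halved. The price
  is that \<open>p'\<close> depends on the query in an unknown way: it has to be searched for, and
  logarithmic time forbids a scan of the grid. The second obstacle is uniformity. One instruction
  list must serve all \<Omega> and \<epsilon>, so the table also carries the scale, the mesh and the
  number of passes. The machine has neither a floor operation nor indirect access to registers.
  Simplices suit it: a cut updates d + 1 vertices by one arithmetic formula, and the volume to be
  bounded is a determinant. No test for success is needed either: every value met is a lower bound
  for \<open>F y\<close>, so it is safe to run a fixed number of passes and keep the
  maximum.\<close>

no_notation scalar_prod (infix "\<bullet>" 70)

section \<open>Supergradients of the distance to the boundary\<close>

text \<open>Walking from \<open>z\<close> in direction \<open>b\<close> for the length
  \<open>b \<bullet> (y - z)\<close> leads to the supporting hyperplane, which contains no interior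
  point. The frontier has therefore been met on the way.\<close>

lemma bdist_le_supporting:
  fixes \<Omega> :: "'a::euclidean_space set"
  assumes "z \<in> \<Omega>" "norm b = 1" and sup: "\<And>w. w \<in> interior \<Omega> \<Longrightarrow> b \<bullet> w < b \<bullet> y"
    and le: "b \<bullet> z \<le> b \<bullet> y"
  shows "bdist \<Omega> z \<le> b \<bullet> (y - z)"
proof -
  define s where "s = b \<bullet> (y - z)"
  define w where "w = z + s *\<^sub>R b"
  have s0: "s \<ge> 0" using le by (simp add: s_def inner_diff_right)
  have bb: "b \<bullet> b = 1" using assms(2) by (simp add: dot_square_norm)
  have "b \<bullet> w = b \<bullet> y" by (simp add: w_def s_def inner_add_right bb inner_diff_right)
  then have wi: "w \<notin> interior \<Omega>" using sup[of w] by auto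
  have "\<exists>u\<in>closed_segment z w. u \<in> frontier \<Omega>"
  proof (cases "w \<in> \<Omega>")
    case True
    then show ?thesis using wi closure_subset by (auto simp: frontier_def)
  next
    case False
    have "closed_segment z w \<inter> frontier \<Omega> \<noteq> {}"
      by (rule connected_Int_frontier) (use assms(1) False in auto)
    then show ?thesis by auto
  qed
  then obtain u where u: "u \<in> closed_segment z w" "u \<in> frontier \<Omega>" by blast
  have "dist z u \<le> dist z w" using u(1) segment_bound(1)[of u z w] by (simp add: dist_norm norm_minus_commute)
  also have "\<dots> = s" using s0 assms(2) by (simp add: w_def dist_norm)
  finally show ?thesis unfolding bdist_def s_def using infdist_le2[OF u(2)] by blast
qed

text \<open>The supergradient is the inward unit normal of a supporting hyperplane at a frontier
  point \<open>y\<close> nearest to \<open>x\<close>. The distance of \<open>z\<close> to this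
  hyperplane is affine in \<open>z\<close>, bounds \<open>bdist \<Omega> z\<close> from above, and
  at \<open>x\<close> is at most \<open>dist x y = bdist \<Omega> x\<close>.\<close>

lemma bdist_supergradient:
  fixes \<Omega> :: "'a::euclidean_space set"
  assumes "convex \<Omega>" "compact \<Omega>" "interior \<Omega> \<noteq> {}" "x \<in> \<Omega>"
  obtains a where "norm a = 1" "\<And>z. z \<in> \<Omega> \<Longrightarrow> bdist \<Omega> z \<le> bdist \<Omega> x + a \<bullet> (z - x)"
proof -
  have "frontier \<Omega> \<noteq> {}"
    using assms by (metis compact_eq_bounded_closed frontier_eq_empty interior_empty not_bounded_UNIV)
  then obtain y where y: "y \<in> frontier \<Omega>" "bdist \<Omega> x = dist x y"
    unfolding bdist_def using infdist_attains_inf[of "frontier \<Omega>" x] frontier_closed by metis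
  have cl: "closed \<Omega>" using assms(2) compact_imp_closed by blast
  have yO: "y \<in> \<Omega>" "y \<notin> rel_interior \<Omega>"
    using y(1) cl assms by (auto simp: frontier_def rel_interior_nonempty_interior)
  obtain b where b: "b \<noteq> 0" "\<And>w. w \<in> \<Omega> \<Longrightarrow> b \<bullet> y \<le> b \<bullet> w"
    "\<And>w. w \<in> rel_interior \<Omega> \<Longrightarrow> b \<bullet> y < b \<bullet> w"
    using supporting_hyperplane_rel_boundary[OF assms(1) yO] by metis
  define a where "a = b /\<^sub>R norm b"
  have a: "norm a = 1" "\<And>w. w \<in> \<Omega> \<Longrightarrow> a \<bullet> y \<le> a \<bullet> w" "\<And>w. w \<in> interior \<Omega> \<Longrightarrow> a \<bullet> y < a \<bullet> w"
    using b cl assms(3) by (auto simp: a_def divide_simps rel_interior_nonempty_interior)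
  show thesis
  proof (rule that[OF a(1)])
    fix z assume z: "z \<in> \<Omega>"
    have "bdist \<Omega> z \<le> (-a) \<bullet> (y - z)"
      by (rule bdist_le_supporting) (use z a in auto)
    also have "\<dots> = (-a) \<bullet> (y - x) + a \<bullet> (z - x)"
      by (simp add: inner_diff_right)
    also have "(-a) \<bullet> (y - x) \<le> norm (-a) * norm (y - x)" by (rule norm_cauchy_schwarz)
    also have "\<dots> = bdist \<Omega> x" using a(1) y(2) by (simp add: dist_norm norm_minus_commute)
    finally show "bdist \<Omega> z \<le> bdist \<Omega> x + a \<bullet> (z - x)" by simp
  qed
qed

lemma bdist_le_diameter:
  fixes \<Omega> :: "'a::euclidean_space set"
  assumes "compact \<Omega>" "x \<in> \<Omega>" "interior \<Omega> \<noteq> {}"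
  shows "bdist \<Omega> x \<le> diameter \<Omega>"
proof -
  have "frontier \<Omega> \<noteq> {}"
    using assms by (metis compact_eq_bounded_closed frontier_eq_empty interior_empty not_bounded_UNIV)
  then obtain y where y: "y \<in> frontier \<Omega>" by blast
  then have "y \<in> \<Omega>" using assms(1) by (simp add: compact_imp_closed frontier_def)
  then have "dist x y \<le> diameter \<Omega>"
    using assms diameter_bounded_bound compact_imp_bounded by blast
  then show ?thesis unfolding bdist_def using infdist_le2[OF y] by blast
qed

text \<open>\<open>q\<close> is the conjugate of \<open>z \<mapsto> |z|\<^sup>2 / 2 - e z\<close>, and \<open>\<zeta> p\<close> a maximiser of \<open>z \<mapsto> p \<bullet> z - |z|\<^sup>2 / 2 + e z\<close>.\<close>

lemma conjugate_first_order:
  fixes Y :: "'a::euclidean_space set" and e :: "'a \<Rightarrow> real"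
  assumes "compact Y" "Y \<noteq> {}" "continuous_on Y e"
    and super: "\<And>y. y \<in> Y \<Longrightarrow> \<exists>a. norm a = 1 \<and> (\<forall>z\<in>Y. e z \<le> e y + a \<bullet> (z - y))"
  obtains q \<zeta> where "\<And>p. \<zeta> p \<in> Y"
    "\<And>p y. y \<in> Y \<Longrightarrow> p \<bullet> y - q p \<le> (norm y)\<^sup>2 / 2 - e y"
    "\<And>p g y. p \<bullet> y - q p \<le> g \<bullet> y - q g + (p - g) \<bullet> (y - \<zeta> g)"
    "\<And>y. y \<in> Y \<Longrightarrow> \<exists>p'. norm (p' - y) = 1 \<and> 
        (\<forall>p. p \<bullet> y - q p \<ge> (norm y)\<^sup>2 / 2 - e y - (norm (p - p'))\<^sup>2 / 2)"
proof -
  define F where "F y = (norm y)\<^sup>2 / 2 - e y" for y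
  have "\<exists>z\<in>Y. \<forall>w\<in>Y. p \<bullet> w - F w \<le> p \<bullet> z - F z" for p
    unfolding F_def by (rule continuous_attains_sup[OF assms(1,2)])
      (auto intro!: continuous_intros assms(3))
  then obtain \<zeta> where \<zeta>: "\<And>p. \<zeta> p \<in> Y" "\<And>p w. w \<in> Y \<Longrightarrow> p \<bullet> w - F w \<le> p \<bullet> \<zeta> p - F (\<zeta> p)"
    by metis
  define q where "q p = p \<bullet> \<zeta> p - F (\<zeta> p)" for p
  show thesis
  proof (rule that[of \<zeta> q])
    show "p \<bullet> y - q p \<le> (norm y)\<^sup>2 / 2 - e y" if "y \<in> Y" for p y
      using \<zeta>(2)[OF that, of p] by (simp add: q_def F_def)
    \<comment> \<open>As a maximum, \<open>q p\<close> is at least the value at the competitor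
      \<open>\<zeta> g\<close>; so \<open>\<zeta> g\<close> is a subgradient of \<open>q\<close> at
      \<open>g\<close>, which rearranges to this cut.\<close>
    show "p \<bullet> y - q p \<le> g \<bullet> y - q g + (p - g) \<bullet> (y - \<zeta> g)" for p g y
      using \<zeta>(2)[OF \<zeta>(1), of p g] by (simp add: q_def algebra_simps)
    show "\<exists>p'. norm (p' - y) = 1 \<and> 
        (\<forall>p. p \<bullet> y - q p \<ge> (norm y)\<^sup>2 / 2 - e y - (norm (p - p'))\<^sup>2 / 2)" if y: "y \<in> Y" for y
    proof -
      obtain a where a: "norm a = 1" "\<And>z. z \<in> Y \<Longrightarrow> e z \<le> e y + a \<bullet> (z - y)"
        using super[OF y] by blast
      \<comment> \<open>Here \<open>p' = y - a\<close>. Bounding \<open>e z\<close> in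
        \<open>q p\<close> by \<open>e y + a \<bullet> (z - y)\<close> leaves a concave quadratic in
        \<open>z\<close> with its peak at \<open>p + a\<close>; the square below, which is that of
        \<open>p + a - z\<close>, completes it.\<close>
      have "p \<bullet> y - q p \<ge> (norm y)\<^sup>2 / 2 - e y - (norm (p - (y - a)))\<^sup>2 / 2" for p
      proof -
        define z where "z = \<zeta> p"
        have "0 \<le> (norm (p - (y - a) - (z - y)))\<^sup>2" by simp
        then show ?thesis
          using a(2)[OF \<zeta>(1), of p] unfolding q_def z_def[symmetric] F_def power2_norm_eq_inner
          by (simp add: algebra_simps inner_commute add_divide_distrib diff_divide_distrib)
      qed
      then show ?thesis using a(1) by (intro exI[of _ "y - a"]) auto
    qed
  qed (rule \<zeta>(1))
qed

section \<open>Cutting simplices\<close>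

definition in_simplex :: "nat \<Rightarrow> (nat \<Rightarrow> nat \<Rightarrow> real) \<Rightarrow> (nat \<Rightarrow> real) \<Rightarrow> bool" where
  "in_simplex d v p \<longleftrightarrow> (\<exists>l. (\<forall>i\<le>d. 0 \<le> l i) \<and> (\<Sum>i\<le>d. l i) = 1 \<and> (\<forall>j<d. p j = (\<Sum>i\<le>d. l i * v i j)))"

text \<open>The determinant of the homogeneous coordinates of the vertices is \<open>fact d\<close> times the
  oriented volume.\<close>

definition hom_mat :: "nat \<Rightarrow> (nat \<Rightarrow> nat \<Rightarrow> real) \<Rightarrow> real mat" where
  "hom_mat d v = Matrix.mat (Suc d) (Suc d) (\<lambda>(i, j). if j < d then v i j else 1)"

abbreviation hom_det :: "nat \<Rightarrow> (nat \<Rightarrow> nat \<Rightarrow> real) \<Rightarrow> real" where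
  "hom_det d v \<equiv> Determinant.det (hom_mat d v)"

text \<open>Shrinks the edges at vertex \<open>k\<close>, where the cut \<open>c \<ge> 0\<close> is largest. The facet opposite to \<open>k\<close>
  is replaced by a combination, with weights \<open>1 - \<theta>\<close> and \<open>\<theta>\<close>, of that facet and the cut.\<close>

definition cut_vertex :: "real \<Rightarrow> (nat \<Rightarrow> real) \<Rightarrow> nat \<Rightarrow> (nat \<Rightarrow> nat \<Rightarrow> real) \<Rightarrow> nat \<Rightarrow> nat \<Rightarrow> real" where
  "cut_vertex \<theta> c k v i j = v k j + (v i j - v k j) / (1 - \<theta> * c i / c k)"

lemma affine_in_simplex:
  fixes l p g :: "nat \<Rightarrow> real"
  assumes "(\<Sum>i\<le>d. l i) = 1" "\<And>j. j < d \<Longrightarrow> p j = (\<Sum>i\<le>d. l i * v i j)"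
  shows "\<alpha> + (\<Sum>j<d. g j * p j) = (\<Sum>i\<le>d. l i * (\<alpha> + (\<Sum>j<d. g j * v i j)))"
proof -
  have "(\<Sum>j<d. g j * p j) = (\<Sum>j<d. \<Sum>i\<le>d. l i * (g j * v i j))"
  proof (rule sum.cong)
    fix j assume "j \<in> {..<d}"
    then have "g j * p j = g j * (\<Sum>i\<le>d. l i * v i j)" by (simp add: assms(2))
    also have "\<dots> = (\<Sum>i\<le>d. g j * (l i * v i j))" by (rule sum_distrib_left)
    finally show "g j * p j = (\<Sum>i\<le>d. l i * (g j * v i j))" by (simp only: mult.left_commute)
  qed simp
  also have "\<dots> = (\<Sum>i\<le>d. l i * (\<Sum>j<d. g j * v i j))"
    by (subst sum.swap) (simp add: sum_distrib_left)
  moreover have "(\<Sum>i\<le>d. l i * \<alpha>) = \<alpha>"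
    by (simp add: assms(1) flip: sum_distrib_right)
  ultimately show ?thesis by (simp add: distrib_left sum.distrib)
qed

lemma in_simplex_affine_le:
  assumes "in_simplex d v p" "\<And>i. i \<le> d \<Longrightarrow> \<alpha> + (\<Sum>j<d. g j * v i j) \<le> M"
  shows "\<alpha> + (\<Sum>j<d. g j * p j) \<le> M"
proof -
  obtain l where l: "\<And>i. i \<le> d \<Longrightarrow> 0 \<le> l i" "(\<Sum>i\<le>d. l i) = 1" "\<And>j. j < d \<Longrightarrow> p j = (\<Sum>i\<le>d. l i * v i j)"
    using assms(1) unfolding in_simplex_def by blast
  have "(\<Sum>i\<le>d. l i * (\<alpha> + (\<Sum>j<d. g j * v i j))) \<le> (\<Sum>i\<le>d. l i * M)"
    by (intro sum_mono mult_left_mono assms(2)) (auto simp: l)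
  then show ?thesis using affine_in_simplex[of l d p v \<alpha> g] l by (simp flip: sum_distrib_right)
qed

text \<open>Explicit barycentric coordinates for the new vertices: \<open>l i\<close> is multiplied
  by \<open>1 - \<theta> * c i / c k\<close>, and the mass \<tau> missing from 1 is given to
  \<open>k\<close>. It is nonnegative, being \<theta> / \<open>c k\<close> times the value of the
  cut at \<open>p\<close>. The new coordinate at \<open>k\<close> is
  \<open>(1 - \<theta>) * l k + \<tau>\<close>, the mixture of old facet and cut.\<close>

lemma in_simplex_cut:
  assumes p: "in_simplex d v p" and k: "k \<le> d" and pos: "0 < c k"
    and le: "\<And>i. i \<le> d \<Longrightarrow> c i \<le> c k" and c: "\<And>i. i \<le> d \<Longrightarrow> c i = \<alpha> + (\<Sum>j<d. g j * v i j)"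
    and kept: "0 \<le> \<alpha> + (\<Sum>j<d. g j * p j)" and \<theta>: "0 \<le> \<theta>" "\<theta> < 1"
  shows "in_simplex d (cut_vertex \<theta> c k v) p"
proof -
  obtain l where l: "\<And>i. i \<le> d \<Longrightarrow> 0 \<le> l i" "(\<Sum>i\<le>d. l i) = 1" "\<And>j. j < d \<Longrightarrow> p j = (\<Sum>i\<le>d. l i * v i j)"
    using p unfolding in_simplex_def by blast
  define x where "x i = c i / c k" for i
  have x1: "x i \<le> 1" if "i \<le> d" for i using le[OF that] pos by (simp add: x_def)
  have pos': "0 < 1 - \<theta> * x i" if "i \<le> d" for i
    using mult_left_mono[OF x1[OF that] \<theta>(1)] \<theta>(2) by simp
  have Lx: "0 \<le> (\<Sum>i\<le>d. l i * x i)"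
  proof -
    have "(\<Sum>i\<le>d. l i * c i) = (\<Sum>i\<le>d. l i * (\<alpha> + (\<Sum>j<d. g j * v i j)))"
      by (intro sum.cong) (auto simp: c)
    then have "0 \<le> (\<Sum>i\<le>d. l i * c i)"
      using kept affine_in_simplex[of l d p v \<alpha> g] l by simp
    moreover have "(\<Sum>i\<le>d. l i * x i) = (\<Sum>i\<le>d. l i * c i) / c k"
      by (simp add: x_def sum_divide_distrib)
    ultimately show ?thesis using pos by simp
  qed
  define \<tau> where "\<tau> = \<theta> * (\<Sum>i\<le>d. l i * x i)"
  define l' where "l' i = l i * (1 - \<theta> * x i) + (if i = k then \<tau> else 0)" for i
  have "0 \<le> l' i" if "i \<le> d" for i
    using l(1)[OF that] pos'[OF that] Lx \<theta> by (simp add: l'_def \<tau>_def)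
  moreover have "(\<Sum>i\<le>d. l i * (1 - \<theta> * x i)) = 1 - \<tau>"
    by (simp add: right_diff_distrib sum_subtractf l(2) \<tau>_def sum_distrib_left mult_ac)
  then have "(\<Sum>i\<le>d. l' i) = 1"
    using k by (simp add: l'_def sum.distrib)
  moreover have "p j = (\<Sum>i\<le>d. l' i * cut_vertex \<theta> c k v i j)" if "j < d" for j
  proof -
    have "l' i * cut_vertex \<theta> c k v i j = l' i * v k j + l i * (v i j - v k j)" if "i \<le> d" for i
    proof -
      have "cut_vertex \<theta> c k v i j = v k j + (v i j - v k j) / (1 - \<theta> * x i)"
        by (simp add: cut_vertex_def x_def)
      then have "(1 - \<theta> * x i) * cut_vertex \<theta> c k v i j = (1 - \<theta> * x i) * v k j + (v i j - v k j)"
        using pos'[OF that] by (simp add: distrib_left)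
      then have "l i * ((1 - \<theta> * x i) * cut_vertex \<theta> c k v i j)
          = l i * ((1 - \<theta> * x i) * v k j + (v i j - v k j))" by simp
      moreover have "cut_vertex \<theta> c k v k j = v k j" by (simp add: cut_vertex_def)
      ultimately show ?thesis unfolding l'_def distrib_right by (simp add: algebra_simps)
    qed
    then have "(\<Sum>i\<le>d. l' i * cut_vertex \<theta> c k v i j) = (\<Sum>i\<le>d. l' i * v k j + l i * (v i j - v k j))"
      by (intro sum.cong) auto
    also have "\<dots> = v k j + (\<Sum>i\<le>d. l i * v i j) - v k j"
      using \<open>(\<Sum>i\<le>d. l' i) = 1\<close> l(2)
      by (simp add: sum.distrib right_diff_distrib sum_subtractf flip: sum_distrib_right)
    finally show ?thesis using l(3)[OF that] by simp
  qed
  ultimately show ?thesis unfolding in_simplex_def by (intro exI[of _ l']) auto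
qed

section \<open>Decrease of the volume under a cut\<close>

lemma prod_ge_one_plus_sum:
  fixes f :: "'a \<Rightarrow> real"
  assumes "finite A" "\<And>i. i \<in> A \<Longrightarrow> 0 \<le> f i"
  shows "1 + (\<Sum>i\<in>A. f i) \<le> (\<Prod>i\<in>A. 1 + f i)"
  using assms
proof (induction A rule: finite_induct)
  case (insert a A)
  have "0 \<le> f a * (\<Sum>i\<in>A. f i)" using insert.prems by (simp add: sum_nonneg)
  then have "1 + (\<Sum>i\<in>insert a A. f i) \<le> (1 + f a) * (1 + (\<Sum>i\<in>A. f i))"
    using insert.hyps by (simp add: algebra_simps)
  also have "\<dots> \<le> (1 + f a) * (\<Prod>i\<in>A. 1 + f i)"
    using insert by (intro mult_left_mono) auto
  finally show ?case using insert.hyps by simp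
qed simp

lemma one_minus_sum_le_prod:
  fixes f :: "'a \<Rightarrow> real"
  assumes "finite A" "\<And>i. i \<in> A \<Longrightarrow> 0 \<le> f i \<and> f i \<le> 1"
  shows "1 - (\<Sum>i\<in>A. f i) \<le> (\<Prod>i\<in>A. 1 - f i)"
  using assms
proof (induction A rule: finite_induct)
  case (insert a A)
  have "0 \<le> f a * (\<Sum>i\<in>A. f i)" using insert.prems by (simp add: sum_nonneg)
  then have "1 - (\<Sum>i\<in>insert a A. f i) \<le> (1 - f a) * (1 - (\<Sum>i\<in>A. f i))"
    using insert.hyps by (simp add: algebra_simps)
  also have "\<dots> \<le> (1 - f a) * (\<Prod>i\<in>A. 1 - f i)"
    using insert by (intro mult_left_mono) auto
  finally show ?case using insert.hyps by simp
qed simp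

text \<open>To first order in \<theta> the product is at least \<open>1 + \<theta> / 2\<close>. With
  \<open>P\<close> and \<open>N\<close> the sums of the positive and of the negated negative terms,
  the second-order loss is \<theta> times \<open>\<theta> * P * (P + 1/2)\<close>. As
  \<open>P\<close> is at most \<open>card A\<close>, the choice of \<theta> keeps the latter factor
  below 1/8. No bound on \<open>N\<close> from above is available, so the negative terms are
  estimated by \<open>1 + \<theta> * N\<close> alone.\<close>

lemma prod_one_minus_ge:
  fixes x :: "'a \<Rightarrow> real"
  assumes fin: "finite A" and le1: "\<And>i. i \<in> A \<Longrightarrow> x i \<le> 1" and s: "(\<Sum>i\<in>A. x i) \<le> - (1/2)"
    and \<theta>: "0 \<le> \<theta>" "\<theta> * (8 * (real (card A) + 1)\<^sup>2) = 1"
  shows "1 + \<theta> / 4 \<le> (\<Prod>i\<in>A. 1 - \<theta> * x i)"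
proof -
  let ?n = "real (card A)"
  define Q where "Q = {i\<in>A. 0 \<le> x i}"
  define R where "R = {i\<in>A. x i < 0}"
  have QR: "A = Q \<union> R" "Q \<inter> R = {}" "finite Q" "finite R" using fin by (auto simp: Q_def R_def)
  define P where "P = (\<Sum>i\<in>Q. x i)"
  define N where "N = (\<Sum>i\<in>R. - x i)"
  have N: "P + 1/2 \<le> N" using s sum.union_disjoint[OF QR(3,4,2), of x] by (simp add: P_def N_def QR(1) sum_negf)
  have P: "0 \<le> P" "P \<le> ?n"
  proof -
    show "0 \<le> P" by (auto simp: P_def Q_def intro: sum_nonneg)
    have "P \<le> (\<Sum>i\<in>Q. 1)" unfolding P_def by (intro sum_mono) (auto simp: Q_def le1)
    also have "\<dots> \<le> ?n" using fin by (auto simp: Q_def intro: card_mono)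
    finally show "P \<le> ?n" .
  qed
  have \<theta>n: "\<theta> * (?n + 1)\<^sup>2 = 1/8" using \<theta>(2) by (simp add: algebra_simps)
  have "\<theta> * 1 \<le> \<theta> * (?n + 1)\<^sup>2" using \<theta>(1) by (intro mult_left_mono) auto
  then have \<theta>8: "\<theta> \<le> 1/8" using \<theta>n by simp
  have "\<theta> * (P * (P + 1/2)) \<le> \<theta> * (?n + 1)\<^sup>2"
    unfolding power2_eq_square using P \<theta>(1) by (intro mult_left_mono mult_mono) auto
  then have b1: "\<theta> * (P * (P + 1/2)) \<le> 1/8" using \<theta>n by simp
  have "\<theta> * P \<le> \<theta> * (?n + 1)\<^sup>2"
    using P \<theta>(1) mult_mono[of P "?n + 1" 1 "?n + 1"]
    by (intro mult_left_mono) (auto simp: power2_eq_square)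
  then have b2: "\<theta> * P \<le> 1/8" using \<theta>n by simp
  have "1 + \<theta>/4 \<le> 1 + \<theta> / 2 - \<theta> * (\<theta> * (P * (P + 1/2)))"
    using mult_left_mono[OF b1 \<theta>(1)] \<theta>(1) by simp
  also have "\<dots> = (1 - \<theta> * P) * (1 + \<theta> * (P + 1/2))" by (simp add: field_simps)
  also have "\<dots> \<le> (1 - \<theta> * P) * (1 + \<theta> * N)"
    using N \<theta>(1) b2 by (intro mult_left_mono add_left_mono) auto
  also have "\<dots> \<le> (\<Prod>i\<in>Q. 1 - \<theta> * x i) * (\<Prod>i\<in>R. 1 + \<theta> * (- x i))"
  proof (rule mult_mono)
    have "0 \<le> \<theta> * x i \<and> \<theta> * x i \<le> 1" if "i \<in> Q" for i
      using that le1[of i] \<theta>8 \<theta>(1) mult_mono[of \<theta> 1 "x i" 1] by (auto simp: Q_def)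
    then show *: "1 - \<theta> * P \<le> (\<Prod>i\<in>Q. 1 - \<theta> * x i)"
      using one_minus_sum_le_prod[OF QR(3), of "\<lambda>i. \<theta> * x i"] by (simp add: P_def sum_distrib_left)
    then show "0 \<le> (\<Prod>i\<in>Q. 1 - \<theta> * x i)" using b2 by simp
    have "0 \<le> \<theta> * - x i" if "i \<in> R" for i using that \<theta>(1) by (intro mult_nonneg_nonneg) (auto simp: R_def)
    then show "1 + \<theta> * N \<le> (\<Prod>i\<in>R. 1 + \<theta> * (- x i))"
      using prod_ge_one_plus_sum[OF QR(4), of "\<lambda>i. \<theta> * - x i"] by (simp add: N_def sum_distrib_left)
    show "0 \<le> 1 + \<theta> * N" using N P \<theta>(1) by simp
  qed
  also have "\<dots> = (\<Prod>i\<in>A. 1 - \<theta> * x i)"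
    using prod.union_disjoint[OF QR(3,4,2), of "\<lambda>i. 1 - \<theta> * x i"] by (simp add: QR(1))
  finally show ?thesis .
qed

text \<open>Multiplication by this matrix mixes each row with row \<open>k\<close>. In the Leibniz
  formula a permutation with nonzero product maps every index to itself or to \<open>k\<close>;
  since it fixes \<open>k\<close> and is injective, it is the identity.\<close>

lemma det_scale_towards_row:
  assumes k: "k < n" and sk: "s k = 1"
  shows "Determinant.det (Matrix.mat n n (\<lambda>(i, j). if i = j then s i else if j = k then 1 - s i else 0))
    = (\<Prod>i<n. s i :: real)" (is "Determinant.det ?E = _")
proof -
  have "Determinant.det ?E = (\<Sum>p | p permutes {0..<n}. signof p * (\<Prod>i=0..<n. ?E $$ (i, p i)))"
    by (rule det_def') simp
  also have "\<dots> = (\<Sum>p \<in> {id}. signof p * (\<Prod>i=0..<n. ?E $$ (i, p i)))"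
  proof (rule sum.mono_neutral_right)
    show "\<forall>p\<in>{p. p permutes {0..<n}} - {id}. signof p * (\<Prod>i=0..<n. ?E $$ (i, p i)) = 0"
    proof
      fix p assume "p \<in> {p. p permutes {0..<n}} - {id}"
      then have p: "p permutes {0..<n}" "p \<noteq> id" by auto
      have "\<exists>i<n. ?E $$ (i, p i) = 0"
      proof (rule ccontr)
        assume "\<not> ?thesis"
        then have nz: "?E $$ (i, p i) \<noteq> 0" if "i < n" for i using that by blast
        have lt: "p i < n" if "i < n" for i using permutes_in_image[OF p(1), of i] that by simp
        have *: "p i = i \<or> p i = k" if "i < n" for i
          using nz[OF that] lt[OF that] that by (auto split: if_splits)
        have pk: "p k = k" using *[OF k] by blast
        have "p i = i" for i
        proof (cases "i < n")
          case True
          then show ?thesis using *[of i] pk permutes_inj[OF p(1)] by (metis injD)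
        next
          case False
          then show ?thesis using p(1) by (simp add: permutes_def)
        qed
        then show False using p(2) by auto
      qed
      then show "signof p * (\<Prod>i=0..<n. ?E $$ (i, p i)) = 0" by auto
    qed
  qed (auto simp: permutes_id finite_permutations)
  also have "\<dots> = (\<Prod>i<n. s i)" by (simp add: lessThan_atLeast0 signof_id)
  finally show ?thesis .
qed

text \<open>Moving the vertices along the edges at \<open>k\<close> is a row operation on
  homogeneous coordinates: the weights \<open>s i\<close> and \<open>1 - s i\<close> add up to 1,
  which preserves the column of ones.\<close>

lemma hom_det_cut_vertex:
  assumes k: "k \<le> d" and nz: "\<And>i. i \<le> d \<Longrightarrow> 1 - \<theta> * c i / c k \<noteq> 0"
  shows "hom_det d (cut_vertex \<theta> c k v) * (\<Prod>i\<in>{..d}-{k}. 1 - \<theta> * c i / c k) = hom_det d v"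
proof -
  define s where "s i = (if i = k then 1 else 1 / (1 - \<theta> * c i / c k))" for i
  let ?E = "Matrix.mat (Suc d) (Suc d) (\<lambda>(i, j). if i = j then s i else if j = k then 1 - s i else 0)"
  have "hom_mat d (cut_vertex \<theta> c k v) = ?E * hom_mat d v"
  proof (rule eq_matI)
    fix i j assume ij: "i < dim_row (?E * hom_mat d v)" "j < dim_col (?E * hom_mat d v)"
    let ?w = "\<lambda>i. if j < d then v i j else 1"
    have "(?E * hom_mat d v) $$ (i, j) =
        (\<Sum>l<Suc d. (if i = l then s i else if l = k then 1 - s i else 0) * ?w l)"
      using ij by (simp add: hom_mat_def scalar_prod_def lessThan_atLeast0)
    also have "\<dots> = (\<Sum>l<Suc d. (if l = i then s i * ?w i else 0) + (if l = k then (1 - s i) * ?w k else 0))"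
      by (intro sum.cong) (auto simp: s_def)
    also have "\<dots> = s i * ?w i + (1 - s i) * ?w k"
      using ij k by (simp add: sum.distrib hom_mat_def del: sum.lessThan_Suc)
    also have "\<dots> = hom_mat d (cut_vertex \<theta> c k v) $$ (i, j)"
      using ij by (auto simp: hom_mat_def s_def cut_vertex_def algebra_simps diff_divide_distrib)
    finally show "hom_mat d (cut_vertex \<theta> c k v) $$ (i, j) = (?E * hom_mat d v) $$ (i, j)" by simp
  qed (auto simp: hom_mat_def)
  then have "hom_det d (cut_vertex \<theta> c k v) = (\<Prod>i<Suc d. s i) * hom_det d v"
    using det_mult[of ?E "Suc d" "hom_mat d v"] det_scale_towards_row[of k "Suc d" s] k
    by (simp add: hom_mat_def s_def)
  moreover have "(\<Prod>i<Suc d. s i) = (\<Prod>i\<in>{..d}-{k}. s i)"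
    using k by (subst prod.remove[of _ k]) (auto simp: s_def lessThan_Suc_atMost)
  moreover have "(\<Prod>i\<in>{..d}-{k}. s i) * (\<Prod>i\<in>{..d}-{k}. 1 - \<theta> * c i / c k) = 1"
    unfolding prod.distrib[symmetric] using nz by (intro prod.neutral) (auto simp: s_def)
  ultimately have "hom_det d (cut_vertex \<theta> c k v) = (\<Prod>i\<in>{..d}-{k}. s i) * hom_det d v"
    and "(\<Prod>i\<in>{..d}-{k}. s i) * (\<Prod>i\<in>{..d}-{k}. 1 - \<theta> * c i / c k) = 1" by simp_all
  then show ?thesis by (simp only: mult.commute[of _ "hom_det d v"] mult.assoc)
qed

text \<open>The sum of the vertex values is d + 1 times the value at the centroid. An exact cut
  through the centroid would make it at most 0; the slack \<open>c k / 2\<close> is reserved for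
  rounding the centroid to the grid. After division by \<open>c k\<close>, the terms other than
  \<open>k\<close> still sum to at most -1/2.\<close>

lemma hom_det_cut_le:
  assumes k: "k \<le> d" and pos: "0 < c k" and le: "\<And>i. i \<le> d \<Longrightarrow> c i \<le> c k"
    and s: "(\<Sum>i\<le>d. c i) \<le> c k / 2" and \<theta>: "\<theta> = 1 / (8 * (real d + 1)\<^sup>2)"
  shows "(1 + \<theta> / 4) * \<bar>hom_det d (cut_vertex \<theta> c k v)\<bar> \<le> \<bar>hom_det d v\<bar>"
proof -
  define x where "x i = c i / c k" for i
  have \<theta>0: "0 < \<theta>" unfolding \<theta> by (intro divide_pos_pos mult_pos_pos zero_less_power) auto
  have "1 \<le> (real d + 1)\<^sup>2" by (intro one_le_power) simp
  then have "1 < 8 * (real d + 1)\<^sup>2" by linarith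
  then have \<theta>1: "\<theta> < 1" unfolding \<theta> by simp
  have x1: "x i \<le> 1" if "i \<le> d" for i using le[OF that] pos by (simp add: x_def)
  have "0 < 1 - \<theta> * x i" if "i \<le> d" for i
    using mult_left_mono[OF x1[OF that] less_imp_le[OF \<theta>0]] \<theta>1 by simp
  then have eq: "hom_det d (cut_vertex \<theta> c k v) * (\<Prod>i\<in>{..d}-{k}. 1 - \<theta> * x i) = hom_det d v"
    using hom_det_cut_vertex[OF k, of \<theta> c v] by (force simp: x_def)
  have "(\<Sum>i\<le>d. x i) \<le> 1/2" using s pos by (simp add: x_def flip: sum_divide_distrib)
  moreover have "(\<Sum>i\<le>d. x i) = 1 + (\<Sum>i\<in>{..d}-{k}. x i)"
    using k pos by (subst sum.remove[of _ k]) (auto simp: x_def)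
  ultimately have "1 + \<theta> / 4 \<le> (\<Prod>i\<in>{..d}-{k}. 1 - \<theta> * x i)"
    using x1 \<theta>0 k \<theta> by (intro prod_one_minus_ge) (auto simp: add_nonneg_eq_0_iff)
  moreover from this have "(\<Prod>i\<in>{..d}-{k}. 1 - \<theta> * x i) > 0" using \<theta>0 by linarith
  ultimately show ?thesis
    unfolding eq[symmetric] abs_mult by (subst mult.commute) (intro mult_mono, auto)
qed

section \<open>Lower bound for the volume of a simplex that contains a ball\<close>

lemma hom_det_corner:
  "hom_det d (\<lambda>i j. w j + (if i = j then r else 0)) = r ^ d"
proof -
  \<comment> \<open>The corner simplex with legs \<open>r\<close> at the origin (\<open>?A\<close>),
    followed by the translation by \<open>w\<close> (\<open>?B\<close>); both are triangular. The
    shape is used for the initial simplex and for a simplex inscribed in the ball.\<close>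
  have "hom_mat d (\<lambda>i j. w j + (if i = j then r else 0)) =
     Matrix.mat (Suc d) (Suc d) (\<lambda>(i, j). if i = j then (if i < d then r else 1) else if j = d then 1 else 0)
     * Matrix.mat (Suc d) (Suc d) (\<lambda>(i, j). if i = j then 1 else if i = d then w j else 0)"
    (is "_ = ?A * ?B")
  proof (rule eq_matI)
    fix i j assume ij: "i < dim_row (?A * ?B)" "j < dim_col (?A * ?B)"
    then have "i < Suc d" "j < Suc d" by auto
    then have "(?A * ?B) $$ (i, j) =
        (\<Sum>l<Suc d. (if i = l then (if i < d then r else 1) else if l = d then 1 else 0)
           * (if l = j then 1 else if l = d then w j else 0))"
      by (simp add: scalar_prod_def lessThan_atLeast0 del: sum.op_ivl_Suc split del: if_split)
    also have "\<dots> = (\<Sum>l<d. (if l = i then (if l = j then r else 0) else 0))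
           + (if d = j then 1 else w j)"
      unfolding sum.lessThan_Suc using ij by (intro arg_cong2[of _ _ _ _ "(+)"] sum.cong) auto
    also have "\<dots> = (if i < d then (if i = j then r else 0) else 0) + (if d = j then 1 else w j)"
      using ij by (simp only: sum.delta finite_lessThan lessThan_iff)
    also have "\<dots> = hom_mat d (\<lambda>i j. w j + (if i = j then r else 0)) $$ (i, j)"
      using ij by (auto simp: hom_mat_def)
    finally show "hom_mat d (\<lambda>i j. w j + (if i = j then r else 0)) $$ (i, j) = (?A * ?B) $$ (i, j)" by simp
  qed (auto simp: hom_mat_def)
  moreover have "Determinant.det ?A = r ^ d"
  proof -
    have "upper_triangular ?A" by auto
    then have "Determinant.det ?A = prod_list (diag_mat ?A)" by (intro det_upper_triangular) auto
    also have "\<dots> = r ^ d" by (simp add: prod_list_diag_prod atLeast0LessThan)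
    finally show ?thesis .
  qed
  moreover have "Determinant.det ?B = 1"
  proof -
    have "Determinant.det ?B = prod_list (diag_mat ?B)" by (rule det_lower_triangular[of "Suc d"]) auto
    also have "\<dots> = 1" by (simp add: prod_list_diag_prod)
    finally show ?thesis .
  qed
  ultimately show ?thesis using det_mult[of ?A "Suc d" ?B] by simp
qed

lemma abs_det_le_fact:
  fixes A :: "real mat"
  assumes "A \<in> carrier_mat n n" "\<And>i j. i < n \<Longrightarrow> j < n \<Longrightarrow> \<bar>A $$ (i, j)\<bar> \<le> 1"
  shows "\<bar>Determinant.det A\<bar> \<le> fact n"
proof -
  have "\<bar>Determinant.det A\<bar> \<le> (\<Sum>p | p permutes {0..<n}. \<bar>signof p * (\<Prod>i=0..<n. A $$ (i, p i))\<bar>)"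
    unfolding det_def'[OF assms(1)] by (rule sum_abs)
  also have "\<dots> \<le> (\<Sum>p | p permutes {0..<n}. 1)"
  proof (rule sum_mono)
    fix p assume "p \<in> {p. p permutes {0..<n}}"
    then have "p i < n" if "i < n" for i using permutes_in_image[of p "{0..<n}" i] that by simp
    then have "(\<Prod>i=0..<n. \<bar>A $$ (i, p i)\<bar>) \<le> (\<Prod>i=0..<n. 1)"
      using assms(2) by (intro prod_mono) auto
    then show "\<bar>signof p * (\<Prod>i=0..<n. A $$ (i, p i))\<bar> \<le> (1::real)"
      by (simp add: abs_mult abs_prod sign_def)
  qed
  also have "\<dots> = fact n" by (simp add: card_permutations)
  finally show ?thesis .
qed

text \<open>The matrix of barycentric coordinates has entries in [0,1], so the Leibniz formula
  bounds its determinant. The crude factor \<open>fact (Suc d)\<close> depends on \<open>d\<close>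
  alone and only affects the constant in the number of passes.\<close>

lemma hom_det_ge_of_in_simplex:
  assumes "\<And>i. i \<le> d \<Longrightarrow> in_simplex d v (w i)"
  shows "\<bar>hom_det d w\<bar> \<le> fact (Suc d) * \<bar>hom_det d v\<bar>"
proof -
  have "\<forall>i\<in>{..d}. \<exists>l. (\<forall>m\<le>d. 0 \<le> l m) \<and> (\<Sum>m\<le>d. l m) = 1 \<and> (\<forall>j<d. w i j = (\<Sum>m\<le>d. l m * v m j))"
    using assms unfolding in_simplex_def by auto
  from bchoice[OF this] obtain l where "\<forall>i\<in>{..d}. (\<forall>m\<le>d. 0 \<le> l i m) \<and> (\<Sum>m\<le>d. l i m) = 1
      \<and> (\<forall>j<d. w i j = (\<Sum>m\<le>d. l i m * v m j))" by blast
  then have l: "\<And>i m. i \<le> d \<Longrightarrow> m \<le> d \<Longrightarrow> 0 \<le> l i m" "\<And>i. i \<le> d \<Longrightarrow> (\<Sum>m\<le>d. l i m) = 1"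
    "\<And>i j. i \<le> d \<Longrightarrow> j < d \<Longrightarrow> w i j = (\<Sum>m\<le>d. l i m * v m j)"
    by simp_all
  let ?L = "Matrix.mat (Suc d) (Suc d) (\<lambda>(i, m). l i m)"
  have "hom_mat d w = ?L * hom_mat d v"
  proof (rule eq_matI)
    fix i j assume ij: "i < dim_row (?L * hom_mat d v)" "j < dim_col (?L * hom_mat d v)"
    then have "(?L * hom_mat d v) $$ (i, j) = (\<Sum>m\<le>d. l i m * (if j < d then v m j else 1))"
      by (simp add: hom_mat_def scalar_prod_def atLeast0LessThan lessThan_Suc_atMost)
    then show "hom_mat d w $$ (i, j) = (?L * hom_mat d v) $$ (i, j)"
      using ij l(2)[of i] l(3)[of i j] by (auto simp: hom_mat_def)
  qed (auto simp: hom_mat_def)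
  then have "hom_det d w = Determinant.det ?L * hom_det d v"
    using det_mult[of ?L "Suc d" "hom_mat d v"] by (simp add: hom_mat_def)
  moreover have "\<bar>Determinant.det ?L\<bar> \<le> fact (Suc d)"
  proof (rule abs_det_le_fact)
    fix i j assume "i < Suc d" "j < Suc d"
    moreover from this have "l i j \<le> (\<Sum>m\<le>d. l i m)"
      by (intro member_le_sum) (auto simp: l)
    ultimately show "\<bar>?L $$ (i, j)\<bar> \<le> 1" using l(1)[of i j] l(2)[of i] by simp
  qed simp
  ultimately show ?thesis by (simp add: abs_mult mult_right_mono del: fact_Suc)
qed

lemma sum_mult_le_L2_set:
  "(\<Sum>i\<in>I. f i * g i) \<le> L2_set f I * L2_set g I"
proof -
  have "(\<Sum>i\<in>I. f i * g i) \<le> (\<Sum>i\<in>I. \<bar>f i\<bar> * \<bar>g i\<bar>)"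
    by (intro sum_mono) (simp flip: abs_mult)
  then show ?thesis using L2_set_mult_ineq[of f g I] by linarith
qed

lemma L2_set_squared: "(L2_set f I)\<^sup>2 = (\<Sum>i\<in>I. (f i)\<^sup>2)"
  by (simp add: L2_set_def sum_nonneg)

definition ball_in_simplex :: "nat \<Rightarrow> (nat \<Rightarrow> nat \<Rightarrow> real) \<Rightarrow> (nat \<Rightarrow> real) \<Rightarrow> real \<Rightarrow> bool" where
  "ball_in_simplex d v q \<rho> \<longleftrightarrow> (\<forall>p. L2_set (\<lambda>j. p j - q j) {..<d} \<le> \<rho> \<longrightarrow> in_simplex d v p)"

text \<open>The ball contains the corner simplex with vertices \<open>q\<close> and \<open>q\<close>
  shifted by \<rho> along each axis. This lower bound is what a long run of unsuccessful cuts would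
  violate.\<close>

lemma ball_in_simplex_det_ge:
  assumes "ball_in_simplex d v q \<rho>" "0 \<le> \<rho>"
  shows "\<rho> ^ d \<le> fact (Suc d) * \<bar>hom_det d v\<bar>"
proof -
  have "in_simplex d v (\<lambda>j. q j + (if i = j then \<rho> else 0))" for i
  proof -
    have "L2_set (\<lambda>j. q j + (if i = j then \<rho> else 0) - q j) {..<d} \<le> (\<Sum>j<d. if j = i then \<rho> else 0)"
      using assms(2) by (intro order_trans[OF L2_set_le_sum_abs] sum_mono) auto
    also have "\<dots> \<le> \<rho>" using assms(2) by (simp add: sum.delta)
    finally show ?thesis
      by (rule assms(1)[unfolded ball_in_simplex_def, rule_format])
  qed
  then have "\<bar>hom_det d (\<lambda>i j. q j + (if i = j then \<rho> else 0))\<bar> \<le> fact (Suc d) * \<bar>hom_det d v\<bar>"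
    by (intro hom_det_ge_of_in_simplex)
  then show ?thesis using assms(2) by (simp add: hom_det_corner)
qed

section \<open>A single cut at a rounded and clamped centroid\<close>

lemma clamp_variational:
  fixes t p :: real
  assumes "\<bar>p\<bar> \<le> 3"
  shows "0 \<le> (max (-3) (min 3 t) - t) * (p - max (-3) (min 3 t))"
  using assms by (auto simp: max_def min_def abs_le_iff intro: mult_nonneg_nonneg mult_nonpos_nonpos)

text \<open>The cut \<open>c\<close> adds the separation of \<open>q\<close> from the points that score worse than the
  grid point \<open>pg\<close> to the separation of the box \<open>[-3,3]\<^sup>d\<close> from the centroid \<open>ce\<close>. When \<open>ce\<close>
  lies in the box, \<open>\<delta> = 0\<close> and the second summand disappears, as \<open>x / 0 = 0\<close>.\<close>

lemma cutting_step:
  fixes y z pg pc ce q c :: "nat \<Rightarrow> real" and v :: "nat \<Rightarrow> nat \<Rightarrow> real"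
  assumes \<rho>: "0 < \<rho>" "\<rho> \<le> 1" and h: "4 * real d * (real d + 1) * h \<le> \<rho>"
    and yz: "L2_set (\<lambda>j. y j - z j) {..<d} \<le> 1"
    and ce: "\<And>j. j < d \<Longrightarrow> ce j = (\<Sum>i\<le>d. v i j) / (real d + 1)"
    and pc: "\<And>j. j < d \<Longrightarrow> pc j = max (-3) (min 3 (ce j))"
    and pg: "\<And>j. j < d \<Longrightarrow> \<bar>pc j - pg j\<bar> \<le> h"
    and \<delta>: "\<delta> = L2_set (\<lambda>j. pc j - ce j) {..<d}"
    and c: "\<And>i. i \<le> d \<Longrightarrow> c i = (\<Sum>j<d. (y j - z j) * (v i j - pg j))
               + 2 * (\<Sum>j<d. (pc j - ce j) * (v i j - pc j)) / \<delta>"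
    and k: "k \<le> d" "\<And>i. i \<le> d \<Longrightarrow> c i \<le> c k"
    and q: "\<And>j. j < d \<Longrightarrow> \<bar>q j\<bar> \<le> 2" and ball: "ball_in_simplex d v q \<rho>"
    and better: "\<And>p. L2_set (\<lambda>j. p j - q j) {..<d} \<le> \<rho> \<Longrightarrow> 0 < (\<Sum>j<d. (p j - pg j) * (y j - z j))"
    and \<theta>: "\<theta> = 1 / (8 * (real d + 1)\<^sup>2)"
  shows "ball_in_simplex d (cut_vertex \<theta> c k v) q \<rho>"
    and "(1 + \<theta> / 4) * \<bar>hom_det d (cut_vertex \<theta> c k v)\<bar> \<le> \<bar>hom_det d v\<bar>"
proof -
  define g where "g j = (y j - z j) + 2 * (pc j - ce j) / \<delta>" for j
  define L where "L p = (\<Sum>j<d. (y j - z j) * (p j - pg j))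
               + 2 * (\<Sum>j<d. (pc j - ce j) * (p j - pc j)) / \<delta>" for p
  define \<alpha> where "\<alpha> = - (\<Sum>j<d. (y j - z j) * pg j) - 2 * (\<Sum>j<d. (pc j - ce j) * pc j) / \<delta>"
  have L: "L p = \<alpha> + (\<Sum>j<d. g j * p j)" for p
    by (simp add: L_def \<alpha>_def g_def algebra_simps sum.distrib sum_subtractf sum_distrib_left
        sum_divide_distrib diff_divide_distrib add_divide_distrib)
  have cL: "c i = L (v i)" if "i \<le> d" for i using c[OF that] by (simp add: L_def)
  have \<delta>0: "0 \<le> \<delta>" by (simp add: \<delta>)
  define N where "N = L2_set g {..<d}"
  have N0: "0 \<le> N" by (simp add: N_def)
  \<comment> \<open>Both summands favour the ball: the first by \<open>better\<close>, the second
    because the ball lies in the box (2 + \<rho> is at most 3) and \<open>pc\<close> is the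
    projection of \<open>ce\<close> to the box.\<close>
  have Lpos: "0 < L p" if p: "L2_set (\<lambda>j. p j - q j) {..<d} \<le> \<rho>" for p
  proof -
    have "\<bar>p j\<bar> \<le> 3" if "j < d" for j
    proof -
      have "\<bar>p j - q j\<bar> \<le> L2_set (\<lambda>j. p j - q j) {..<d}"
        using member_le_L2_set[of "{..<d}" j "\<lambda>j. \<bar>p j - q j\<bar>"] that by (simp add: L2_set_def)
      then show ?thesis using p \<rho>(2) q[OF that] by linarith
    qed
    then have "0 \<le> (\<Sum>j<d. (pc j - ce j) * (p j - pc j))"
      using clamp_variational pc by (intro sum_nonneg) simp
    then have "0 \<le> 2 * (\<Sum>j<d. (pc j - ce j) * (p j - pc j)) / \<delta>" using \<delta>0 by simp
    then show ?thesis using better[OF p] by (simp add: L_def mult.commute)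
  qed
  \<comment> \<open>Depth of the cut: \<open>L\<close> is positive even at the lowest point of the
    ball, at distance \<rho> from \<open>q\<close> against the gradient, so \<open>L q\<close> is at
    least \<open>\<rho> * N\<close>; the largest vertex value dominates \<open>L q\<close>.\<close>
  have ck: "0 < c k \<and> \<rho> * N \<le> c k"
  proof -
    have q0: "L2_set (\<lambda>j. q j - q j) {..<d} \<le> \<rho>" using \<rho> by (simp add: L2_set_def)
    have "\<rho> * N \<le> L q"
    proof (cases "N = 0")
      case True
      then show ?thesis using Lpos[OF q0] by simp
    next
      case False
      then have "N > 0" using N0 by simp
      define p where "p j = q j - \<rho> / N * g j" for j
      have "L2_set (\<lambda>j. p j - q j) {..<d} = L2_set (\<lambda>j. \<rho> / N * g j) {..<d}"
        by (simp add: p_def L2_set_def power_mult_distrib)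
      also have "\<dots> = \<rho> / N * N"
        unfolding N_def by (rule L2_set_right_distrib[symmetric]) (use \<rho> in simp)
      finally have "0 < L p" using \<open>N > 0\<close> by (intro Lpos) simp
      moreover have "L p = L q - \<rho> / N * N\<^sup>2"
        unfolding L p_def N_def L2_set_squared
        by (simp add: algebra_simps sum_subtractf sum_distrib_left power2_eq_square)
      ultimately show ?thesis using \<open>N > 0\<close> by (simp add: power2_eq_square)
    qed
    moreover have "L q \<le> c k"
      unfolding L
    proof (rule in_simplex_affine_le)
      show "in_simplex d v q" using ball q0 unfolding ball_in_simplex_def by blast
      show "\<alpha> + (\<Sum>j<d. g j * v i j) \<le> c k" if "i \<le> d" for i
        using k(2)[OF that] unfolding cL[OF that] L .
    qed
    ultimately show ?thesis using Lpos[OF q0] by simp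
  qed
  \<comment> \<open>The rounding error has to be measured against the gradient norm
    \<open>N\<close>. If \<delta> = 0, then \<open>N = ?m\<close>. Otherwise the second summand has
    gradient norm 2, so \<open>N \<ge> 2 - ?m \<ge> 1\<close>. The factor 2 in the cut serves this
    bound; it also makes the term \<open>- 2 * \<delta>\<close> outweigh the clamping error
    \<open>?m * \<delta>\<close>.\<close>
  have Lce: "L ce \<le> real d * h * N"
  proof -
    let ?m = "L2_set (\<lambda>j. y j - z j) {..<d}"
    have h0: "0 \<le> real d * h"
    proof (cases "d = 0")
      case False
      then show ?thesis using pg[of 0] by simp
    qed simp
    have e: "L2_set (\<lambda>j. pc j - pg j) {..<d} \<le> real d * h"
      using sum_bounded_above[of "{..<d}" "\<lambda>j. \<bar>pc j - pg j\<bar>" h] pg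
      by (intro order_trans[OF L2_set_le_sum_abs]) auto
    have "(\<Sum>j<d. (pc j - ce j) * (ce j - pc j)) = - \<delta>\<^sup>2"
      unfolding \<delta> L2_set_squared sum_negf[symmetric]
      by (intro sum.cong) (auto simp: power2_eq_square algebra_simps)
    then have "L ce = (\<Sum>j<d. (y j - z j) * (ce j - pc j)) + (\<Sum>j<d. (y j - z j) * (pc j - pg j)) - 2 * \<delta>"
      by (simp add: L_def power2_eq_square algebra_simps flip: sum.distrib)
    also have "(\<Sum>j<d. (y j - z j) * (ce j - pc j)) \<le> ?m * L2_set (\<lambda>j. ce j - pc j) {..<d}"
      by (rule sum_mult_le_L2_set)
    also have "L2_set (\<lambda>j. ce j - pc j) {..<d} = \<delta>"
      by (simp add: \<delta> L2_set_def power2_commute)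
    also have "(\<Sum>j<d. (y j - z j) * (pc j - pg j)) \<le> ?m * L2_set (\<lambda>j. pc j - pg j) {..<d}"
      by (rule sum_mult_le_L2_set)
    also have "\<dots> \<le> ?m * (real d * h)" using e by (intro mult_left_mono) auto
    also have "?m * \<delta> \<le> 1 * \<delta>" using yz \<delta>0 by (intro mult_right_mono) auto
    finally have Lc: "L ce \<le> ?m * (real d * h) - \<delta>" by simp
    show ?thesis
    proof (cases "\<delta> = 0")
      case True
      then have "g = (\<lambda>j. y j - z j)" by (simp add: g_def fun_eq_iff)
      then have "N = ?m" by (simp add: N_def)
      then show ?thesis using Lc True by (simp add: mult_ac)
    next
      case False
      then have "\<delta> > 0" using \<delta>0 by simp
      have "L2_set (\<lambda>j. g j + - (y j - z j)) {..<d} \<le> N + L2_set (\<lambda>j. - (y j - z j)) {..<d}"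
        unfolding N_def by (rule L2_set_triangle_ineq)
      also have "L2_set (\<lambda>j. - (y j - z j)) {..<d} = ?m" by (simp add: L2_set_def power2_commute)
      also have "L2_set (\<lambda>j. g j + - (y j - z j)) {..<d} = L2_set (\<lambda>j. (2 / \<delta>) * (pc j - ce j)) {..<d}"
        by (simp add: g_def)
      also have "\<dots> = 2 / \<delta> * \<delta>"
        unfolding \<delta> by (rule L2_set_right_distrib[symmetric]) simp
      finally have "1 \<le> N" using \<open>\<delta> > 0\<close> yz by simp
      then have "?m * (real d * h) \<le> N * (real d * h)" using yz h0 by (intro mult_right_mono) auto
      then show ?thesis using Lc \<delta>0 by (simp add: mult_ac)
    qed
  qed
  have "(\<Sum>i\<le>d. c i) = (\<Sum>i\<le>d. \<alpha> + (\<Sum>j<d. g j * v i j))"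
    by (intro sum.cong) (auto simp: cL L)
  also have "\<dots> = (real d + 1) * \<alpha> + (\<Sum>j<d. g j * (\<Sum>i\<le>d. v i j))"
    by (subst sum.distrib, subst sum.swap) (simp add: sum_distrib_left)
  also have "\<dots> = (real d + 1) * L ce"
    unfolding L distrib_left sum_distrib_left[of "real d + 1"] by (auto simp: ce intro!: sum.cong)
  also have "\<dots> \<le> (real d + 1) * (real d * h * N)" using Lce by (intro mult_left_mono) auto
  \<comment> \<open>The mesh is fine enough to make the total rounding error at most a quarter of
    the depth \<open>\<rho> * N\<close> of the cut.\<close>
  also have "\<dots> = (4 * real d * (real d + 1) * h) * N / 4" by simp
  also have "\<dots> \<le> \<rho> * N / 4" using h N0 by (intro divide_right_mono mult_right_mono) auto
  also have "\<dots> \<le> c k / 2" using ck by linarith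
  finally have sum_c: "(\<Sum>i\<le>d. c i) \<le> c k / 2" .
  then show "(1 + \<theta> / 4) * \<bar>hom_det d (cut_vertex \<theta> c k v)\<bar> \<le> \<bar>hom_det d v\<bar>"
    using ck k \<theta> by (intro hom_det_cut_le) auto
  have "1 \<le> (real d + 1)\<^sup>2" by (intro one_le_power) simp
  then have "1 < 8 * (real d + 1)\<^sup>2" by linarith
  then have \<theta>1: "0 \<le> \<theta>" "\<theta> < 1" unfolding \<theta> by simp_all
  show "ball_in_simplex d (cut_vertex \<theta> c k v) q \<rho>"
    unfolding ball_in_simplex_def
  proof (intro allI impI)
    fix p assume p: "L2_set (\<lambda>j. p j - q j) {..<d} \<le> \<rho>"
    show "in_simplex d (cut_vertex \<theta> c k v) p"
    proof (rule in_simplex_cut[where \<alpha> = \<alpha> and g = g])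
      show "in_simplex d v p" using ball p unfolding ball_in_simplex_def by blast
      show "c i = \<alpha> + (\<Sum>j<d. g j * v i j)" if "i \<le> d" for i
        unfolding cL[OF that] L ..
      show "0 \<le> \<alpha> + (\<Sum>j<d. g j * p j)" using Lpos[OF p] unfolding L by simp
    qed (use ck k \<theta>1 in auto)
  qed
qed

section \<open>Straight-line code with one loop\<close>

datatype (plugins only: size) var = Inp nat | Coord nat | Vert nat nat | Cent nat | Clamp nat | Idx nat | Grid nat
  | Code | Arg nat | Conj | Best | Dist | Cut nat | Top | Wt nat | Piv nat
  | Iters | Count | Scale | Mesh | Side | Res

instance var :: countable by countable_datatype

datatype (plugins only: size) binop = PlusOp | MinusOp | TimesOp | DivideOp

datatype (plugins only: size) expr = Num real | Var var | Bin binop expr expr | Root expr | Fetch expr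

abbreviation "Plus \<equiv> Bin PlusOp"
abbreviation "Minus \<equiv> Bin MinusOp"
abbreviation "Times \<equiv> Bin TimesOp"
abbreviation "Divide \<equiv> Bin DivideOp"

fun binop_fun :: "binop \<Rightarrow> real \<Rightarrow> real \<Rightarrow> real" where
  "binop_fun PlusOp = (+)" | "binop_fun MinusOp = (-)"
| "binop_fun TimesOp = (*)" | "binop_fun DivideOp = (/)"

fun eval_expr :: "real list \<Rightarrow> (var \<Rightarrow> real) \<Rightarrow> expr \<Rightarrow> real" where
  "eval_expr D \<sigma> (Num c) = c"
| "eval_expr D \<sigma> (Var x) = \<sigma> x"
| "eval_expr D \<sigma> (Bin f a b) = binop_fun f (eval_expr D \<sigma> a) (eval_expr D \<sigma> b)"
| "eval_expr D \<sigma> (Root a) = sqrt (eval_expr D \<sigma> a)"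
| "eval_expr D \<sigma> (Fetch a) = load D (eval_expr D \<sigma> a)"

fun expr_vars :: "expr \<Rightarrow> var set" where
  "expr_vars (Num c) = {}"
| "expr_vars (Var x) = {x}"
| "expr_vars (Bin f a b) = expr_vars a \<union> expr_vars b"
| "expr_vars (Root a) = expr_vars a"
| "expr_vars (Fetch a) = expr_vars a"

lemma eval_expr_cong:
  "(\<And>x. x \<in> expr_vars e \<Longrightarrow> \<sigma> x = \<tau> x) \<Longrightarrow> eval_expr D \<sigma> e = eval_expr D \<tau> e"
  by (induction e) auto

type_synonym assignment = "var \<times> expr"

definition exec_asg :: "real list \<Rightarrow> assignment \<Rightarrow> (var \<Rightarrow> real) \<Rightarrow> var \<Rightarrow> real" where
  "exec_asg D a \<sigma> = \<sigma>(fst a := eval_expr D \<sigma> (snd a))"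

abbreviation exec_asgs :: "real list \<Rightarrow> assignment list \<Rightarrow> (var \<Rightarrow> real) \<Rightarrow> var \<Rightarrow> real" where
  "exec_asgs D \<equiv> fold (exec_asg D)"

text \<open>Variables and the evaluation stack occupy registers of different parity above the
  \<open>d\<close> input registers.\<close>

definition reg :: "nat \<Rightarrow> var \<Rightarrow> nat" where
  "reg d x = (case x of Inp j \<Rightarrow> if j < d then j else d + 2 * to_nat x | _ \<Rightarrow> d + 2 * to_nat x)"

definition tmp :: "nat \<Rightarrow> nat \<Rightarrow> nat" where "tmp d s = d + 2 * s + 1"

lemma reg_eq_iff [simp]: "reg d x = reg d y \<longleftrightarrow> x = y"
proof
  assume "reg d x = reg d y"
  then show "x = y"
    by (cases "\<exists>j<d. x = Inp j"; cases "\<exists>j<d. y = Inp j") (auto simp: reg_def split: var.splits if_splits)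
qed simp

lemma reg_neq_tmp [simp]: "reg d x \<noteq> tmp d s" "tmp d s \<noteq> reg d x"
proof -
  have odd: "2 * m \<noteq> Suc (2 * n)" for m n :: nat by presburger
  show "reg d x \<noteq> tmp d s"
    by (cases x) (auto simp: reg_def tmp_def odd)
  then show "tmp d s \<noteq> reg d x" by simp
qed

lemma tmp_eq_iff [simp]: "tmp d s = tmp d s' \<longleftrightarrow> s = s'"
  by (simp add: tmp_def)

section \<open>Compilation of assignments and execution of the compiled code\<close>

fun binop_instr :: "binop \<Rightarrow> nat \<Rightarrow> nat \<Rightarrow> nat \<Rightarrow> instr" where
  "binop_instr PlusOp = Add" | "binop_instr MinusOp = Sub"
| "binop_instr TimesOp = Mul" | "binop_instr DivideOp = Dv"

text \<open>Stack discipline: the value is left in temporary \<open>s\<close>, while lower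
  temporaries and all variables stay intact. A register is copied by adding zero, as there is no
  move instruction.\<close>

fun compile_expr :: "nat \<Rightarrow> expr \<Rightarrow> nat \<Rightarrow> instr list" where
  "compile_expr d (Num c) s = [Cst (tmp d s) c]"
| "compile_expr d (Var x) s = [Cst (tmp d s) 0, Add (tmp d s) (reg d x) (tmp d s)]"
| "compile_expr d (Bin f a b) s = compile_expr d a s @ compile_expr d b (Suc s)
     @ [binop_instr f (tmp d s) (tmp d s) (tmp d (Suc s))]"
| "compile_expr d (Root a) s = compile_expr d a s @ [Sqr (tmp d s) (tmp d s)]"
| "compile_expr d (Fetch a) s = compile_expr d a s @ [Ld (tmp d s) (tmp d s)]"

definition compile_asg :: "nat \<Rightarrow> assignment \<Rightarrow> instr list" where
  "compile_asg d a = compile_expr d (snd a) 0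
     @ [Cst (tmp d 1) 0, Add (reg d (fst a)) (tmp d 0) (tmp d 1)]"

definition compile :: "nat \<Rightarrow> assignment list \<Rightarrow> instr list" where
  "compile d as = concat (map (compile_asg d) as)"

fun straight :: "instr \<Rightarrow> bool" where
  "straight (Jle _ _ _) = False" | "straight (Jmp _) = False" | "straight (Halt _) = False"
| "straight _ = True"

text \<open>Effect of jump-free code on the registers alone; the counter 0 is a dummy, since only
  jumps and \<open>Halt\<close> treat the counter specially.\<close>

definition exec_line :: "real list \<Rightarrow> instr list \<Rightarrow> (nat \<Rightarrow> real) \<Rightarrow> nat \<Rightarrow> real" where
  "exec_line D = fold (\<lambda>i r. snd (exec_instr D i (0, r)))"

lemma exec_line_simps [simp]:
  "exec_line D [] r = r"
  "exec_line D (i # is) r = exec_line D is (snd (exec_instr D i (0, r)))"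
  "exec_line D (is @ is') r = exec_line D is' (exec_line D is r)"
  by (simp_all add: exec_line_def)

lemma exec_binop_instr [simp]:
  "exec_instr D (binop_instr f i j k) (pc, r) = (Suc pc, r(i := binop_fun f (r j) (r k)))"
  by (cases f) simp_all

lemma straight_binop_instr [simp]: "straight (binop_instr f i j k)"
  by (cases f) simp_all

lemma exec_compile_expr_unchanged:
  "(\<And>u. s \<le> u \<Longrightarrow> l \<noteq> tmp d u) \<Longrightarrow> exec_line D (compile_expr d e s) r l = r l"
  by (induction e arbitrary: s r) simp_all

lemma exec_compile_expr:
  "exec_line D (compile_expr d e s) r (tmp d s) = eval_expr D (r \<circ> reg d) e"
proof (induction e arbitrary: s r)
  case (Bin f a b)
  have "exec_line D (compile_expr d a s) r \<circ> reg d = r \<circ> reg d"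
    by (simp add: fun_eq_iff exec_compile_expr_unchanged)
  then show ?case by (simp add: Bin exec_compile_expr_unchanged)
qed simp_all

lemma exec_compile: "exec_line D (compile d as) r \<circ> reg d = exec_asgs D as (r \<circ> reg d)"
proof (induction "as" arbitrary: r)
  case (Cons a as)
  have "exec_line D (compile_asg d a) r \<circ> reg d = exec_asg D a (r \<circ> reg d)"
    by (auto simp: fun_eq_iff compile_asg_def exec_asg_def exec_compile_expr exec_compile_expr_unchanged)
  moreover have "compile d (a # as) = compile_asg d a @ compile d as" by (simp add: compile_def)
  ultimately show ?case by (simp only: exec_line_simps Cons fold_simps)
qed (simp add: compile_def)

lemma straight_compile_expr: "i \<in> set (compile_expr d e s) \<Longrightarrow> straight i"
  by (induction e arbitrary: s) auto

lemma straight_compile: "i \<in> set (compile d as) \<Longrightarrow> straight i"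
  by (auto simp: compile_def compile_asg_def dest: straight_compile_expr split: if_split_asm)

lemma run_add: "run P D s (m + n) = run P D (run P D s m) n"
  unfolding run_def by (subst add.commute) (simp only: funpow_add comp_apply)

lemma exec_instr_straight:
  "straight i \<Longrightarrow> exec_instr D i (pc, r) = (Suc pc, snd (exec_instr D i (0, r)))"
  by (cases i) auto

lemma run_straight:
  assumes "P = pre @ is @ post" "\<And>i. i \<in> set is \<Longrightarrow> straight i"
  shows "run P D (length pre, r) (length is) = (length pre + length is, exec_line D is r)"
  using assms
proof (induction "is" arbitrary: pre r)
  case (Cons i "is")
  have "run P D (length pre, r) (length (i # is)) = run P D (step P D (length pre, r)) (length is)"
    by (simp add: run_def funpow_swap1)
  also have "step P D (length pre, r) = (length (pre @ [i]), snd (exec_instr D i (0, r)))"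
  proof -
    have "P ! length pre = i" "length pre < length P" by (simp_all add: Cons.prems(1))
    moreover have "straight i" using Cons.prems(2) by simp
    ultimately show ?thesis using exec_instr_straight[of i D "length pre" r] by (simp add: step_def)
  qed
  also have "run P D \<dots> (length is) =
      (length (pre @ [i]) + length is, exec_line D is (snd (exec_instr D i (0, r))))"
    by (rule Cons.IH) (use Cons.prems in auto)
  finally show ?case by simp
qed (simp add: run_def)

definition loop_program :: "nat \<Rightarrow> assignment list \<Rightarrow> assignment list \<Rightarrow> var \<Rightarrow> var
    \<Rightarrow> assignment list \<Rightarrow> var \<Rightarrow> instr list" where
  "loop_program d init body i n final res =
     compile d init @ compile d body @
     [Jle (reg d i) (reg d n) (length (compile d init))] @ compile d final @ [Halt (reg d res)]"

text \<open>All three pieces are straight-line, so the running time is exact: \<open>Suc N\<close>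
  passes, each with one extra instruction for the test. The test comes after the body; it jumps back
  after passes 1 to \<open>N\<close> and falls through after pass \<open>Suc N\<close>.\<close>

lemma loop_program_halts:
  fixes x :: "'a::euclidean_space"
  assumes d: "d = DIM('a)" and inp: "\<And>j. j < d \<Longrightarrow> start (Inp j) = x \<bullet> basis_list ! j"
    and zero: "\<And>v. (\<And>j. j < d \<Longrightarrow> v \<noteq> Inp j) \<Longrightarrow> start v = 0"
    and \<sigma>: "\<sigma> 0 = exec_asgs D init start" "\<And>t. \<sigma> (Suc t) = exec_asgs D body (\<sigma> t)"
    and cont: "\<And>t. 0 < t \<Longrightarrow> t \<le> N \<Longrightarrow> \<sigma> t i \<le> \<sigma> t n" and stop: "\<sigma> (Suc N) n < \<sigma> (Suc N) i"
  shows "halts_with (loop_program d init body i n final res) D x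
    (length (compile d init) + (Suc N) * Suc (length (compile d body)) + length (compile d final))
    (exec_asgs D final (\<sigma> (Suc N)) res)"
proof -
  define P where "P = loop_program d init body i n final res"
  define Q where "Q = (\<lambda>as. length (compile d as))"
  have P1: "P = [] @ compile d init @ (compile d body @
     [Jle (reg d i) (reg d n) (Q init)] @ compile d final @ [Halt (reg d res)])"
    and P2: "P = compile d init @ compile d body @
     ([Jle (reg d i) (reg d n) (Q init)] @ compile d final @ [Halt (reg d res)])"
    and P3: "P = (compile d init @ compile d body @
     [Jle (reg d i) (reg d n) (Q init)]) @ compile d final @ [Halt (reg d res)]"
    by (simp_all add: P_def loop_program_def Q_def)
  have line: "run P D (length pre, r) (Q as) = (length pre + Q as, exec_line D (compile d as) r)"
    if "P = pre @ compile d as @ post" for pre as post r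
    unfolding Q_def by (rule run_straight[OF that]) (rule straight_compile)
  have pass: "\<exists>r'. run P D (Q init, r) (Suc (Q body)) =
      (if \<sigma> (Suc t) i \<le> \<sigma> (Suc t) n then Q init else Suc (Q init + Q body), r')
      \<and> r' \<circ> reg d = \<sigma> (Suc t)" if r: "r \<circ> reg d = \<sigma> t" for r t
  proof -
    let ?r = "exec_line D (compile d body) r"
    have rr: "?r \<circ> reg d = \<sigma> (Suc t)" by (simp only: exec_compile r \<sigma>)
    then have val: "?r (reg d i) = \<sigma> (Suc t) i" "?r (reg d n) = \<sigma> (Suc t) n"
      by (auto simp: fun_eq_iff)
    have "P ! (Q init + Q body) = Jle (reg d i) (reg d n) (Q init)" "Q init + Q body < length P"
      by (simp_all add: P2 Q_def nth_append)
    then have "run P D (Q init + Q body, ?r) 1 =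
        (if \<sigma> (Suc t) i \<le> \<sigma> (Suc t) n then Q init else Suc (Q init + Q body), ?r)"
      by (simp add: run_def step_def val)
    then show ?thesis
      using line[OF P2, of r] rr run_add[of P D "(Q init, r)" "Q body" 1]
      by (auto simp: Q_def)
  qed
  have init: "init_regs x \<circ> reg d = start"
  proof
    fix v
    show "(init_regs x \<circ> reg d) v = start v"
    proof (cases "\<exists>j<d. v = Inp j")
      case True
      then show ?thesis using inp d by (auto simp: reg_def init_regs_def)
    next
      case False
      then have "\<not> reg d v < d" by (auto simp: reg_def split: var.splits)
      then show ?thesis using False zero[of v] d by (auto simp: init_regs_def)
    qed
  qed
  \<comment> \<open>\<open>\<sigma> 0\<close> is the state before the first pass. The induction
    stops at \<open>N\<close>, because the pass after that leaves the loop and is treated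
    separately.\<close>
  have iter: "\<exists>r. run P D (0, init_regs x) (Q init + t * Suc (Q body)) = (Q init, r) \<and> r \<circ> reg d = \<sigma> t"
    if "t \<le> N" for t
    using that
  proof (induction t)
    case 0
    have "run P D (0, init_regs x) (Q init) = (Q init, exec_line D (compile d init) (init_regs x))"
      using line[OF P1, of "init_regs x"] by simp
    moreover have "exec_line D (compile d init) (init_regs x) \<circ> reg d = \<sigma> 0"
      by (simp only: exec_compile init \<sigma>)
    ultimately show ?case unfolding mult_0 add_0_right by blast
  next
    case (Suc t)
    then obtain r where r: "run P D (0, init_regs x) (Q init + t * Suc (Q body)) = (Q init, r)"
      "r \<circ> reg d = \<sigma> t" using Suc_leD by blast
    have "Q init + Suc t * Suc (Q body) = Q init + t * Suc (Q body) + Suc (Q body)" by simp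
    moreover obtain r' where "run P D (Q init, r) (Suc (Q body)) = (Q init, r')" "r' \<circ> reg d = \<sigma> (Suc t)"
      using pass[OF r(2)] cont[of "Suc t"] Suc.prems by (metis zero_less_Suc)
    ultimately show ?case using r(1) run_add by metis
  qed
  obtain r where r: "run P D (0, init_regs x) (Q init + N * Suc (Q body)) = (Q init, r)"
      "r \<circ> reg d = \<sigma> N" using iter by blast
  then obtain r' where r': "run P D (Q init, r) (Suc (Q body)) = (Suc (Q init + Q body), r')"
      "r' \<circ> reg d = \<sigma> (Suc N)" using pass[OF r(2)] stop unfolding not_le[symmetric] by (metis (full_types))
  let ?r = "exec_line D (compile d final) r'"
  have lf: "run P D (Suc (Q init + Q body), r') (Q final) = (Suc (Q init + Q body) + Q final, ?r)"
    using line[OF P3, of r'] by (simp add: Q_def)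
  have "Q init + Suc N * Suc (Q body) + Q final = Q init + N * Suc (Q body) + Suc (Q body) + Q final" by simp
  then have "run P D (0, init_regs x) (Q init + Suc N * Suc (Q body) + Q final)
      = (Suc (Q init + Q body) + Q final, ?r)"
    using run_add[of P D "(0, init_regs x)" "Q init + N * Suc (Q body)" "Suc (Q body)"]
      run_add[of P D "(0, init_regs x)" "Q init + N * Suc (Q body) + Suc (Q body)" "Q final"]
    by (simp only: r(1) r'(1) lf)
  moreover have "P ! (Suc (Q init + Q body) + Q final) = Halt (reg d res)"
    "Suc (Q init + Q body) + Q final < length P"
    by (simp_all add: P3 Q_def nth_append)
  moreover have "?r (reg d res) = exec_asgs D final (\<sigma> (Suc N)) res"
    using fun_cong[OF exec_compile[of D d final r'], of res] unfolding r'(2) by simp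
  ultimately show ?thesis unfolding halts_with_def P_def[symmetric] Q_def by auto
qed

section \<open>The query program\<close>

lemma exec_asgs_frame: "x \<notin> fst ` set as \<Longrightarrow> exec_asgs D as \<sigma> x = \<sigma> x"
  by (induction "as" arbitrary: \<sigma>) (auto simp: exec_asg_def)

definition family :: "('i \<Rightarrow> var) \<Rightarrow> ('i \<Rightarrow> expr) \<Rightarrow> 'i list \<Rightarrow> assignment list" where
  "family A e is = map (\<lambda>i. (A i, e i)) is"

lemma exec_family_frame: "x \<notin> A ` set is \<Longrightarrow> exec_asgs D (family A e is) \<sigma> x = \<sigma> x"
  by (rule exec_asgs_frame) (auto simp: family_def)

text \<open>Sequential execution acts like a simultaneous assignment, because \<open>e i\<close>
  reads no member of the family other than \<open>A i\<close>. Reading \<open>A i\<close> itself is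
  allowed, so that the vertices can be updated in place.\<close>

lemma exec_family:
  assumes "distinct is" "inj A" "\<And>i. expr_vars (e i) \<inter> A ` (- {i}) = {}" "i \<in> set is"
  shows "exec_asgs D (family A e is) \<sigma> (A i) = eval_expr D \<sigma> (e i)"
  using assms(1,4)
proof (induction "is" arbitrary: \<sigma>)
  case (Cons a "is")
  let ?\<sigma> = "exec_asg D (A a, e a) \<sigma>"
  have *: "exec_asgs D (family A e (a # is)) \<sigma> = exec_asgs D (family A e is) ?\<sigma>"
    by (simp add: family_def)
  show ?case
  proof (cases "i = a")
    case True
    then have "A i \<notin> A ` set is" using Cons.prems(1) inj_image_mem_iff[OF assms(2)] by auto
    then show ?thesis using True by (simp add: * exec_family_frame) (simp add: exec_asg_def)
  next
    case False
    have "eval_expr D ?\<sigma> (e i) = eval_expr D \<sigma> (e i)"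
    proof (rule eval_expr_cong)
      fix x assume "x \<in> expr_vars (e i)"
      then have "x \<noteq> A a" using assms(3)[of i] False by auto
      then show "?\<sigma> x = \<sigma> x" by (simp add: exec_asg_def)
    qed
    then show ?thesis using Cons False by (simp add: *)
  qed
qed simp

fun sum_expr :: "nat \<Rightarrow> (nat \<Rightarrow> expr) \<Rightarrow> expr" where
  "sum_expr 0 f = Num 0"
| "sum_expr (Suc n) f = Plus (sum_expr n f) (f n)"

fun prod_expr :: "nat \<Rightarrow> (nat \<Rightarrow> expr) \<Rightarrow> expr" where
  "prod_expr 0 f = Num 1"
| "prod_expr (Suc n) f = Times (prod_expr n f) (f n)"

text \<open>Half of a + b + |a - b|, with the absolute value as the root of a square: a comparison
  without a jump, which keeps the loop body straight-line.\<close>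

definition max_expr :: "expr \<Rightarrow> expr \<Rightarrow> expr" where
  "max_expr a b = Divide (Plus (Plus a b) (Root (Times (Minus a b) (Minus a b)))) (Num 2)"

definition min_expr :: "expr \<Rightarrow> expr \<Rightarrow> expr" where
  "min_expr a b = Divide (Minus (Plus a b) (Root (Times (Minus a b) (Minus a b)))) (Num 2)"

fun Max_expr :: "nat \<Rightarrow> (nat \<Rightarrow> expr) \<Rightarrow> expr" where
  "Max_expr 0 f = f 0"
| "Max_expr (Suc n) f = max_expr (Max_expr n f) (f (Suc n))"

text \<open>The indicator of \<open>a = 0\<close>, because \<open>0 / 0 = 0\<close>.\<close>

definition is_zero_expr :: "expr \<Rightarrow> expr" where
  "is_zero_expr a = Minus (Num 1) (Divide a a)"

lemma eval_sum_expr [simp]: "eval_expr D \<sigma> (sum_expr n f) = (\<Sum>i<n. eval_expr D \<sigma> (f i))"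
  by (induction n) simp_all

lemma eval_prod_expr [simp]: "eval_expr D \<sigma> (prod_expr n f) = (\<Prod>i<n. eval_expr D \<sigma> (f i))"
  by (induction n) (simp_all add: mult.commute)

lemma eval_max_expr [simp]: "eval_expr D \<sigma> (max_expr a b) = max (eval_expr D \<sigma> a) (eval_expr D \<sigma> b)"
  by (simp add: max_expr_def max_def real_sqrt_abs2)

lemma eval_min_expr [simp]: "eval_expr D \<sigma> (min_expr a b) = min (eval_expr D \<sigma> a) (eval_expr D \<sigma> b)"
  by (simp add: min_expr_def min_def real_sqrt_abs2)

lemma eval_Max_expr:
  "\<exists>k\<le>n. eval_expr D \<sigma> (Max_expr n f) = eval_expr D \<sigma> (f k)"
  "i \<le> n \<Longrightarrow> eval_expr D \<sigma> (f i) \<le> eval_expr D \<sigma> (Max_expr n f)"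
proof (induction n)
  case (Suc n)
  {
    case 1
    from Suc obtain k where "k \<le> n" "eval_expr D \<sigma> (Max_expr n f) = eval_expr D \<sigma> (f k)" by auto
    then show ?case
      by (cases "eval_expr D \<sigma> (f k) \<le> eval_expr D \<sigma> (f (Suc n))")
        (auto simp: max_def intro: exI[of _ "Suc n"] exI[of _ k])
  next
    case 2
    then show ?case using Suc by (auto simp: le_Suc_eq)
  }
qed auto

lemma eval_is_zero_expr [simp]:
  "eval_expr D \<sigma> (is_zero_expr a) = of_bool (eval_expr D \<sigma> a = 0)"
  by (simp add: is_zero_expr_def)

lemma expr_vars_sum_expr [simp]: "expr_vars (sum_expr n f) = (\<Union>i<n. expr_vars (f i))"
  by (induction n) (simp_all add: lessThan_Suc Un_commute)

lemma expr_vars_prod_expr [simp]: "expr_vars (prod_expr n f) = (\<Union>i<n. expr_vars (f i))"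
  by (induction n) (simp_all add: lessThan_Suc Un_commute)

lemma expr_vars_max_expr [simp]: "expr_vars (max_expr a b) = expr_vars a \<union> expr_vars b"
  by (auto simp: max_expr_def)

lemma expr_vars_min_expr [simp]: "expr_vars (min_expr a b) = expr_vars a \<union> expr_vars b"
  by (auto simp: min_expr_def)

lemma expr_vars_is_zero_expr [simp]: "expr_vars (is_zero_expr a) = expr_vars a"
  by (simp add: is_zero_expr_def)

definition cut_rate :: "nat \<Rightarrow> real" where "cut_rate d = 1 / (8 * (real d + 1)\<^sup>2)"

abbreviation vertex_pairs :: "nat \<Rightarrow> (nat \<times> nat) list" where
  "vertex_pairs d \<equiv> List.product [0..<Suc d] [0..<d]"

text \<open>The corner at -3 in all coordinates and the legs \<open>6 * real d\<close> give a
  simplex around the box [-3,3]^d. The start value -1 of \<open>Best\<close> is a lower bound for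
  the value sought, as the scaled distance is at most 1.\<close>

definition query_init :: "nat \<Rightarrow> assignment list" where
  "query_init d =
    [(Iters, Fetch (Num 0)), (Scale, Fetch (Num 1)), (Mesh, Fetch (Num 2)), (Side, Fetch (Num 3)),
     (Count, Num 0), (Best, Num (-1))]
    @ family Coord (\<lambda>j. Divide (Minus (Var (Inp j)) (Fetch (Num (real (4 + j))))) (Var Scale)) [0..<d]
    @ family (\<lambda>(i, j). Vert i j) (\<lambda>(i, j). Num (- 3 + (if i = j then 6 * real d else 0))) (vertex_pairs d)"

abbreviation cent_asgs :: "nat \<Rightarrow> assignment list" where
  "cent_asgs d \<equiv> family Cent (\<lambda>j. Divide (sum_expr (Suc d) (\<lambda>i. Var (Vert i j))) (Num (real d + 1))) [0..<d]"

abbreviation clamp_asgs :: "nat \<Rightarrow> assignment list" where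
  "clamp_asgs d \<equiv> family Clamp (\<lambda>j. max_expr (Num (- 3)) (min_expr (Num 3) (Var (Cent j)))) [0..<d]"

abbreviation idx_asgs :: "nat \<Rightarrow> assignment list" where
  "idx_asgs d \<equiv> family Idx (\<lambda>j. Fetch (Plus (Num (real (4 + d)))
    (Divide (Plus (Var (Clamp j)) (Num 3)) (Var Mesh)))) [0..<d]"

abbreviation grid_asgs :: "nat \<Rightarrow> assignment list" where
  "grid_asgs d \<equiv> family Grid (\<lambda>j. Minus (Times (Var Mesh) (Var (Idx j))) (Num 3)) [0..<d]"

text \<open>The indices are the digits, in base \<open>Side\<close>, of the row number of the grid
  point; each row occupies d + 1 entries.\<close>

abbreviation code_asgs :: "nat \<Rightarrow> assignment list" where
  "code_asgs d \<equiv> [(Code, Plus (Plus (Num (real (4 + d))) (Var Side)) (Times (Num (real (Suc d)))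
    (sum_expr d (\<lambda>j. Times (Var (Idx j)) (prod_expr j (\<lambda>_. Var Side))))))]"

abbreviation conj_asgs :: "nat \<Rightarrow> assignment list" where
  "conj_asgs d \<equiv> [(Conj, Fetch (Var Code))]"

abbreviation arg_asgs :: "nat \<Rightarrow> assignment list" where
  "arg_asgs d \<equiv> family Arg (\<lambda>j. Fetch (Plus (Var Code) (Num (real (Suc j))))) [0..<d]"

abbreviation best_asgs :: "nat \<Rightarrow> assignment list" where
  "best_asgs d \<equiv> [(Best, max_expr (Var Best)
    (Minus (sum_expr d (\<lambda>j. Times (Var (Grid j)) (Var (Coord j)))) (Var Conj)))]"

abbreviation dist_asgs :: "nat \<Rightarrow> assignment list" where
  "dist_asgs d \<equiv> [(Dist, Root (sum_expr d (\<lambda>j. Times (Minus (Var (Clamp j)) (Var (Cent j)))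
    (Minus (Var (Clamp j)) (Var (Cent j))))))]"

abbreviation cut_asgs :: "nat \<Rightarrow> assignment list" where
  "cut_asgs d \<equiv> family Cut (\<lambda>i. Plus
    (sum_expr d (\<lambda>j. Times (Minus (Var (Coord j)) (Var (Arg j))) (Minus (Var (Vert i j)) (Var (Grid j)))))
    (Divide (Times (Num 2) (sum_expr d (\<lambda>j. Times (Minus (Var (Clamp j)) (Var (Cent j)))
      (Minus (Var (Vert i j)) (Var (Clamp j)))))) (Var Dist))) [0..<Suc d]"

abbreviation top_asgs :: "nat \<Rightarrow> assignment list" where
  "top_asgs d \<equiv> [(Top, Max_expr d (\<lambda>i. Var (Cut i)))]"

text \<open>Registers cannot be addressed by a computed index, so the top vertex is selected by 0-1
  weights. The product suppresses all but the first maximum; with ties, the bare indicators would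
  add up several vertices.\<close>

abbreviation wt_asgs :: "nat \<Rightarrow> assignment list" where
  "wt_asgs d \<equiv> family Wt (\<lambda>i. Times (is_zero_expr (Minus (Var (Cut i)) (Var Top)))
    (prod_expr i (\<lambda>l. Minus (Num 1) (is_zero_expr (Minus (Var (Cut l)) (Var Top)))))) [0..<Suc d]"

abbreviation piv_asgs :: "nat \<Rightarrow> assignment list" where
  "piv_asgs d \<equiv> family Piv (\<lambda>j. sum_expr (Suc d) (\<lambda>i. Times (Var (Wt i)) (Var (Vert i j)))) [0..<d]"

abbreviation vert_asgs :: "nat \<Rightarrow> assignment list" where
  "vert_asgs d \<equiv> family (\<lambda>(i, j). Vert i j) (\<lambda>(i, j). Plus (Var (Piv j)) (Divide (Minus (Var (Vert i j)) (Var (Piv j)))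
    (Minus (Num 1) (Divide (Times (Num (cut_rate d)) (Var (Cut i))) (Var Top))))) (vertex_pairs d)"

abbreviation count_asgs :: "nat \<Rightarrow> assignment list" where
  "count_asgs d \<equiv> [(Count, Plus (Var Count) (Num 1))]"

definition query_body :: "nat \<Rightarrow> assignment list" where
  "query_body d = cent_asgs d @ clamp_asgs d @ idx_asgs d @ grid_asgs d @ code_asgs d @ conj_asgs d @ arg_asgs d
    @ best_asgs d @ dist_asgs d @ cut_asgs d @ top_asgs d @ wt_asgs d @ piv_asgs d @ vert_asgs d @ count_asgs d"

text \<open>Undoes the passage from the distance to half the squared norm minus the distance, and
  then the scaling.\<close>

definition query_final :: "nat \<Rightarrow> assignment list" where
  "query_final d = [(Res, Times (Var Scale)
     (Minus (Divide (sum_expr d (\<lambda>j. Times (Var (Coord j)) (Var (Coord j)))) (Num 2)) (Var Best)))]"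

lemma exec_singleton: "exec_asgs D [(x, e)] \<sigma> = \<sigma>(x := eval_expr D \<sigma> e)"
  by (simp add: exec_asg_def)

lemma sum_first_indicator:
  assumes "k \<le> d" "P k"
  obtains m where "m \<le> d" "P m"
    "\<And>w :: nat \<Rightarrow> real. (\<Sum>i\<le>d. of_bool (P i) * (\<Prod>l<i. 1 - of_bool (P l)) * w i) = w m"
proof -
  define m where "m = (LEAST k. P k)"
  have m: "P m" "m \<le> k" and least: "\<And>l. l < m \<Longrightarrow> \<not> P l"
    unfolding m_def using assms(2) by (auto intro: LeastI Least_le dest: not_less_Least)
  have "of_bool (P i) * (\<Prod>l<i. 1 - of_bool (P l)) * w i = (if i = m then w m else 0)" for i and w :: "nat \<Rightarrow> real"
  proof (cases i m rule: linorder_cases)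
    case greater
    then have "(\<Prod>l<i. 1 - of_bool (P l) :: real) = 0" using m(1) by (intro prod_zero) auto
    then show ?thesis using greater by simp
  qed (auto simp: m(1) least intro!: prod.neutral)
  then have "(\<Sum>i\<le>d. of_bool (P i) * (\<Prod>l<i. 1 - of_bool (P l)) * w i) = w m" for w :: "nat \<Rightarrow> real"
    using m(2) assms(1) by (simp add: sum.delta)
  then show thesis using that[of m] m assms(1) by simp
qed

text \<open>Each intermediate quantity is assigned at one stage of a pass and left alone afterwards,
  so all of them can be read off the final state \<tau>. What one pass hands to the next, apart from
  unchanged constants, is \<open>Vert\<close>, \<open>Best\<close> and \<open>Count\<close>.\<close>

lemma query_body_spec:
  fixes d D \<sigma>
  defines "\<tau> \<equiv> exec_asgs D (query_body d) \<sigma>"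
  shows "\<And>x. x \<in> {Iters, Scale, Mesh, Side} \<union> range Coord \<Longrightarrow> \<tau> x = \<sigma> x"
    and "\<tau> Count = \<sigma> Count + 1"
    and "\<And>j. j < d \<Longrightarrow> \<tau> (Cent j) = (\<Sum>i\<le>d. \<sigma> (Vert i j)) / (real d + 1)"
    and "\<And>j. j < d \<Longrightarrow> \<tau> (Clamp j) = max (- 3) (min 3 (\<tau> (Cent j)))"
    and "\<And>j. j < d \<Longrightarrow> \<tau> (Idx j) = load D (real (4 + d) + (\<tau> (Clamp j) + 3) / \<sigma> Mesh)"
    and "\<And>j. j < d \<Longrightarrow> \<tau> (Grid j) = \<sigma> Mesh * \<tau> (Idx j) - 3"
    and "\<tau> Code = real (4 + d) + \<sigma> Side + real (Suc d) * (\<Sum>j<d. \<tau> (Idx j) * \<sigma> Side ^ j)"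
    and "\<tau> Conj = load D (\<tau> Code)"
    and "\<And>j. j < d \<Longrightarrow> \<tau> (Arg j) = load D (\<tau> Code + real (Suc j))"
    and "\<tau> Best = max (\<sigma> Best) ((\<Sum>j<d. \<tau> (Grid j) * \<sigma> (Coord j)) - \<tau> Conj)"
    and "\<tau> Dist = L2_set (\<lambda>j. \<tau> (Clamp j) - \<tau> (Cent j)) {..<d}"
    and "\<And>i. i \<le> d \<Longrightarrow> \<tau> (Cut i) = (\<Sum>j<d. (\<sigma> (Coord j) - \<tau> (Arg j)) * (\<sigma> (Vert i j) - \<tau> (Grid j)))
          + 2 * (\<Sum>j<d. (\<tau> (Clamp j) - \<tau> (Cent j)) * (\<sigma> (Vert i j) - \<tau> (Clamp j))) / \<tau> Dist"
    and "\<exists>k\<le>d. (\<forall>i\<le>d. \<tau> (Cut i) \<le> \<tau> (Cut k)) \<and> (\<forall>i\<le>d. \<forall>j<d. \<tau> (Vert i j) =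
          cut_vertex (cut_rate d) (\<lambda>i. \<tau> (Cut i)) k (\<lambda>i j. \<sigma> (Vert i j)) i j)"
proof -
  define s1 where "s1 = exec_asgs D (cent_asgs d) \<sigma>"
  define s2 where "s2 = exec_asgs D (clamp_asgs d) s1"
  define s3 where "s3 = exec_asgs D (idx_asgs d) s2"
  define s4 where "s4 = exec_asgs D (grid_asgs d) s3"
  define s5 where "s5 = exec_asgs D (code_asgs d) s4"
  define s6 where "s6 = exec_asgs D (conj_asgs d) s5"
  define s7 where "s7 = exec_asgs D (arg_asgs d) s6"
  define s8 where "s8 = exec_asgs D (best_asgs d) s7"
  define s9 where "s9 = exec_asgs D (dist_asgs d) s8"
  define s10 where "s10 = exec_asgs D (cut_asgs d) s9"
  define s11 where "s11 = exec_asgs D (top_asgs d) s10"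
  define s12 where "s12 = exec_asgs D (wt_asgs d) s11"
  define s13 where "s13 = exec_asgs D (piv_asgs d) s12"
  define s14 where "s14 = exec_asgs D (vert_asgs d) s13"
  define s15 where "s15 = exec_asgs D (count_asgs d) s14"
  have \<tau>: "\<tau> = s15"
    by (simp only: \<tau>_def query_body_def fold_append o_apply s1_def s2_def s3_def s4_def s5_def s6_def s7_def s8_def s9_def s10_def s11_def s12_def s13_def s14_def s15_def)
  have f1: "s1 x = \<sigma> x" if "x \<notin> range Cent" for x
    unfolding s1_def by (rule exec_family_frame) (use that in auto)
  have f2: "s2 x = s1 x" if "x \<notin> range Clamp" for x
    unfolding s2_def by (rule exec_family_frame) (use that in auto)
  have f3: "s3 x = s2 x" if "x \<notin> range Idx" for x
    unfolding s3_def by (rule exec_family_frame) (use that in auto)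
  have f4: "s4 x = s3 x" if "x \<notin> range Grid" for x
    unfolding s4_def by (rule exec_family_frame) (use that in auto)
  have f5: "s5 x = s4 x" if "x \<noteq> Code" for x
    unfolding s5_def exec_singleton using that by simp
  have f6: "s6 x = s5 x" if "x \<noteq> Conj" for x
    unfolding s6_def exec_singleton using that by simp
  have f7: "s7 x = s6 x" if "x \<notin> range Arg" for x
    unfolding s7_def by (rule exec_family_frame) (use that in auto)
  have f8: "s8 x = s7 x" if "x \<noteq> Best" for x
    unfolding s8_def exec_singleton using that by simp
  have f9: "s9 x = s8 x" if "x \<noteq> Dist" for x
    unfolding s9_def exec_singleton using that by simp
  have f10: "s10 x = s9 x" if "x \<notin> range Cut" for x
    unfolding s10_def by (rule exec_family_frame) (use that in auto)
  have f11: "s11 x = s10 x" if "x \<noteq> Top" for x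
    unfolding s11_def exec_singleton using that by simp
  have f12: "s12 x = s11 x" if "x \<notin> range Wt" for x
    unfolding s12_def by (rule exec_family_frame) (use that in auto)
  have f13: "s13 x = s12 x" if "x \<notin> range Piv" for x
    unfolding s13_def by (rule exec_family_frame) (use that in auto)
  have f14: "s14 x = s13 x" if "x \<notin> range (\<lambda>(i, j). Vert i j)" for x
    unfolding s14_def by (rule exec_family_frame) (use that in auto)
  have f15: "s15 x = s14 x" if "x \<noteq> Count" for x
    unfolding s15_def exec_singleton using that by simp
  have e1: "s1 (Cent j) = (\<Sum>i\<le>d. \<sigma> (Vert i j)) / (real d + 1)" if "j < d" for j
    unfolding s1_def by (subst exec_family) (use that in \<open>auto simp: inj_on_def simp del: upt_Suc simp flip: lessThan_Suc_atMost\<close>)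
  have e2: "s2 (Clamp j) = max (- 3) (min 3 (s1 (Cent j)))" if "j < d" for j
    unfolding s2_def by (subst exec_family) (use that in \<open>auto simp: inj_on_def simp del: upt_Suc simp flip: lessThan_Suc_atMost\<close>)
  have e3: "s3 (Idx j) = load D (real (4 + d) + (s2 (Clamp j) + 3) / s2 Mesh)" if "j < d" for j
    unfolding s3_def by (subst exec_family) (use that in \<open>auto simp: inj_on_def simp del: upt_Suc simp flip: lessThan_Suc_atMost\<close>)
  have e4: "s4 (Grid j) = s3 Mesh * s3 (Idx j) - 3" if "j < d" for j
    unfolding s4_def by (subst exec_family) (use that in \<open>auto simp: inj_on_def simp del: upt_Suc simp flip: lessThan_Suc_atMost\<close>)
  have e5: "s5 Code = real (4 + d) + s4 Side + real (Suc d) * (\<Sum>j<d. s4 (Idx j) * s4 Side ^ j)"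
    unfolding s5_def exec_singleton by simp
  have e6: "s6 Conj = load D (s5 Code)"
    unfolding s6_def exec_singleton by simp
  have e7: "s7 (Arg j) = load D (s6 Code + real (Suc j))" if "j < d" for j
    unfolding s7_def by (subst exec_family) (use that in \<open>auto simp: inj_on_def simp del: upt_Suc simp flip: lessThan_Suc_atMost\<close>)
  have e8: "s8 Best = max (s7 Best) ((\<Sum>j<d. s7 (Grid j) * s7 (Coord j)) - s7 Conj)"
    unfolding s8_def exec_singleton by simp
  have e9: "s9 Dist = sqrt (\<Sum>j<d. (s8 (Clamp j) - s8 (Cent j)) * (s8 (Clamp j) - s8 (Cent j)))"
    unfolding s9_def exec_singleton by simp
  have e10: "s10 (Cut i) = (\<Sum>j<d. (s9 (Coord j) - s9 (Arg j)) * (s9 (Vert i j) - s9 (Grid j)))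
        + 2 * (\<Sum>j<d. (s9 (Clamp j) - s9 (Cent j)) * (s9 (Vert i j) - s9 (Clamp j))) / s9 Dist" if "i \<le> d" for i
    unfolding s10_def by (subst exec_family) (use that in \<open>auto simp: inj_on_def simp del: upt_Suc simp flip: lessThan_Suc_atMost\<close>)
  obtain k0 where k0: "k0 \<le> d" "s11 Top = s10 (Cut k0)"
    using eval_Max_expr(1)[of d D s10 "\<lambda>i. Var (Cut i)"] unfolding s11_def exec_singleton by auto
  have e11: "s10 (Cut i) \<le> s11 Top" if "i \<le> d" for i
    using eval_Max_expr(2)[OF that, of D s10 "\<lambda>i. Var (Cut i)"] unfolding s11_def exec_singleton by simp
  have e12: "s12 (Wt i) = of_bool (s11 (Cut i) = s11 Top) * (\<Prod>l<i. 1 - of_bool (s11 (Cut l) = s11 Top))" if "i \<le> d" for i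
    unfolding s12_def by (subst exec_family) (use that in \<open>auto simp: inj_on_def simp del: upt_Suc simp flip: lessThan_Suc_atMost\<close>)
  have e13: "s13 (Piv j) = (\<Sum>i\<le>d. s12 (Wt i) * s12 (Vert i j))" if "j < d" for j
    unfolding s13_def by (subst exec_family) (use that in \<open>auto simp: inj_on_def simp del: upt_Suc simp flip: lessThan_Suc_atMost\<close>)
  have e14: "s14 (Vert i j) = s13 (Piv j) + (s13 (Vert i j) - s13 (Piv j)) / (1 - cut_rate d * s13 (Cut i) / s13 Top)"
    if "i \<le> d" "j < d" for i j
    unfolding s14_def
    by (subst exec_family[where A = "\<lambda>(i, j). Vert i j" and i = "(i, j)", unfolded prod.case])
      (use that in \<open>auto simp: inj_on_def distinct_product simp del: upt_Suc\<close>)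
  have e15: "s15 Count = s14 Count + 1"
    unfolding s15_def exec_singleton by simp
  note frames = f1 f2 f3 f4 f5 f6 f7 f8 f9 f10 f11 f12 f13 f14 f15 image_iff split_paired_Ex
  show "\<And>x. x \<in> {Iters, Scale, Mesh, Side} \<union> range Coord \<Longrightarrow> \<tau> x = \<sigma> x"
    unfolding \<tau> by (auto simp: frames)
  show "\<tau> Count = \<sigma> Count + 1" unfolding \<tau> by (simp add: e15 frames)
  show "\<tau> (Cent j) = (\<Sum>i\<le>d. \<sigma> (Vert i j)) / (real d + 1)" if "j < d" for j
    unfolding \<tau> using that by (simp add: e1 frames)
  show "\<tau> (Clamp j) = max (- 3) (min 3 (\<tau> (Cent j)))" if "j < d" for j
    unfolding \<tau> using that by (simp add: e2 frames)
  show "\<tau> (Idx j) = load D (real (4 + d) + (\<tau> (Clamp j) + 3) / \<sigma> Mesh)" if "j < d" for j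
    unfolding \<tau> using that by (simp add: e3 frames)
  show "\<tau> (Grid j) = \<sigma> Mesh * \<tau> (Idx j) - 3" if "j < d" for j
    unfolding \<tau> using that by (simp add: e4 frames)
  show "\<tau> Code = real (4 + d) + \<sigma> Side + real (Suc d) * (\<Sum>j<d. \<tau> (Idx j) * \<sigma> Side ^ j)"
    unfolding \<tau> by (simp add: e5 frames)
  show "\<tau> Conj = load D (\<tau> Code)" unfolding \<tau> by (simp add: e6 frames)
  show "\<tau> (Arg j) = load D (\<tau> Code + real (Suc j))" if "j < d" for j
    unfolding \<tau> using that by (simp add: e7 frames)
  show "\<tau> Best = max (\<sigma> Best) ((\<Sum>j<d. \<tau> (Grid j) * \<sigma> (Coord j)) - \<tau> Conj)"
    unfolding \<tau> by (simp add: e8 frames)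
  show "\<tau> Dist = L2_set (\<lambda>j. \<tau> (Clamp j) - \<tau> (Cent j)) {..<d}"
    unfolding \<tau> by (simp add: e9 frames L2_set_def power2_eq_square)
  show "\<tau> (Cut i) = (\<Sum>j<d. (\<sigma> (Coord j) - \<tau> (Arg j)) * (\<sigma> (Vert i j) - \<tau> (Grid j)))
          + 2 * (\<Sum>j<d. (\<tau> (Clamp j) - \<tau> (Cent j)) * (\<sigma> (Vert i j) - \<tau> (Clamp j))) / \<tau> Dist"
    if "i \<le> d" for i unfolding \<tau> using that by (simp add: e10 frames)
  obtain k where k: "k \<le> d" "s11 (Cut k) = s11 Top"
    "\<And>w :: nat \<Rightarrow> real. (\<Sum>i\<le>d. of_bool (s11 (Cut i) = s11 Top)
        * (\<Prod>l<i. 1 - of_bool (s11 (Cut l) = s11 Top)) * w i) = w k"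
    using sum_first_indicator[of k0 d "\<lambda>i. s11 (Cut i) = s11 Top"] k0 by (auto simp: frames)
  have piv: "s13 (Piv j) = \<sigma> (Vert k j)" if "j < d" for j
    unfolding e13[OF that] using k(3)[of "\<lambda>i. \<sigma> (Vert i j)"] by (simp add: e12 frames)
  have "\<tau> (Cut i) \<le> \<tau> (Cut k)" if "i \<le> d" for i
    using e11[OF that] k(2) unfolding \<tau> by (simp add: frames)
  moreover have "\<tau> (Vert i j) = cut_vertex (cut_rate d) (\<lambda>i. \<tau> (Cut i)) k (\<lambda>i j. \<sigma> (Vert i j)) i j"
    if "i \<le> d" "j < d" for i j
    using e14[OF that] k(2) piv[OF that(2)] unfolding \<tau> cut_vertex_def by (simp add: frames)
  ultimately show "\<exists>k\<le>d. (\<forall>i\<le>d. \<tau> (Cut i) \<le> \<tau> (Cut k)) \<and> (\<forall>i\<le>d. \<forall>j<d. \<tau> (Vert i j) =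
          cut_vertex (cut_rate d) (\<lambda>i. \<tau> (Cut i)) k (\<lambda>i j. \<sigma> (Vert i j)) i j)"
    using k(1) by blast
qed

section \<open>The table\<close>

lemma sum_digits_less:
  fixes k :: "nat \<Rightarrow> nat"
  assumes "\<And>i. i < n \<Longrightarrow> k i < m"
  shows "(\<Sum>i<n. k i * m ^ i) < m ^ n"
  using assms
proof (induction n)
  case (Suc n)
  have "(\<Sum>i<Suc n. k i * m ^ i) < m ^ n + k n * m ^ n" using Suc by simp
  also have "\<dots> = Suc (k n) * m ^ n" by simp
  also have "\<dots> \<le> m * m ^ n" using Suc.prems[of n] by (intro mult_right_mono) auto
  finally show ?case by simp
qed simp

text \<open>Links the two sides of the table: its rows are filled by decoding the row number,
  whereas a query encodes the indices into one.\<close>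

lemma digit_of_sum_digits:
  fixes k :: "nat \<Rightarrow> nat"
  assumes "\<And>i. i < n \<Longrightarrow> k i < m" "j < n"
  shows "(\<Sum>i<n. k i * m ^ i) div m ^ j mod m = k j"
  using assms
proof (induction n)
  case (Suc n)
  have m: "m > 0" using Suc.prems(1)[of n] by simp
  show ?case
  proof (cases "j = n")
    case True
    have "(\<Sum>i<n. k i * m ^ i) < m ^ n" using Suc.prems(1) by (intro sum_digits_less) simp
    then show ?thesis using True m Suc.prems(1)[of n] by simp
  next
    case False
    then have j: "j < n" using Suc.prems(2) by simp
    then obtain r where r: "n = Suc (j + r)" using less_iff_Suc_add by auto
    have "(\<Sum>i<Suc n. k i * m ^ i) = (\<Sum>i<n. k i * m ^ i) + (k n * m ^ r * m) * m ^ j"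
      by (simp add: r power_add mult_ac del: sum.lessThan_Suc) (simp add: r power_add mult_ac)
    also have "\<dots> div m ^ j = (\<Sum>i<n. k i * m ^ i) div m ^ j + k n * m ^ r * m"
      using m by simp
    finally show ?thesis using Suc.IH Suc.prems(1) j by simp
  qed
qed simp

lemma load_add:
  assumes "0 \<le> t" "a + nat \<lfloor>t\<rfloor> < length D"
  shows "load D (real a + t) = D ! (a + nat \<lfloor>t\<rfloor>)"
proof -
  have "\<lfloor>real a + t\<rfloor> = int a + \<lfloor>t\<rfloor>" by simp
  then have "nat \<lfloor>real a + t\<rfloor> = a + nat \<lfloor>t\<rfloor>" using assms(1) by (simp add: nat_add_distrib)
  then show ?thesis using assms by (simp add: load_def)
qed

lemma load_of_nat: "a < length D \<Longrightarrow> load D (real a) = D ! a"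
  by (simp add: load_def)

definition table_point :: "nat \<Rightarrow> real \<Rightarrow> nat \<Rightarrow> nat \<Rightarrow> real" where
  "table_point m h u j = h * real (u div m ^ j mod m) - 3"

text \<open>The entries \<open>real i\<close>, \<open>i < m\<close>, after the header turn the rounding of the address in
  \<^const>\<open>load\<close> into a floor operation.\<close>

definition query_table :: "nat \<Rightarrow> nat \<Rightarrow> real \<Rightarrow> real \<Rightarrow> nat \<Rightarrow> (nat \<Rightarrow> real)
    \<Rightarrow> ((nat \<Rightarrow> real) \<Rightarrow> real) \<Rightarrow> ((nat \<Rightarrow> real) \<Rightarrow> nat \<Rightarrow> real) \<Rightarrow> real list" where
  "query_table d N \<Delta> h m x0 q \<zeta> = ([real N, \<Delta>, h, real m] @ map x0 [0..<d]) @ map real [0..<m]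
     @ map (\<lambda>w. case w mod Suc d of 0 \<Rightarrow> q (table_point m h (w div Suc d))
          | Suc j \<Rightarrow> \<zeta> (table_point m h (w div Suc d)) j) [0..<Suc d * m ^ d]"

lemma length_query_table: "length (query_table d N \<Delta> h m x0 q \<zeta>) = 4 + d + m + Suc d * m ^ d"
  by (simp add: query_table_def)

lemma load_query_table:
  fixes d N \<Delta> h m x0 q \<zeta>
  defines "D \<equiv> query_table d N \<Delta> h m x0 q \<zeta>"
  shows "load D 0 = real N" "load D 1 = \<Delta>" "load D 2 = h" "load D 3 = real m"
    and "\<And>j. j < d \<Longrightarrow> load D (real (4 + j)) = x0 j"
    and "\<And>t. 0 \<le> t \<Longrightarrow> t < real m \<Longrightarrow> load D (real (4 + d) + t) = real (nat \<lfloor>t\<rfloor>)"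
    and "\<And>u. u < m ^ d \<Longrightarrow> load D (real (4 + d + m + Suc d * u)) = q (table_point m h u)"
    and "\<And>u j. u < m ^ d \<Longrightarrow> j < d \<Longrightarrow>
           load D (real (4 + d + m + Suc d * u + Suc j)) = \<zeta> (table_point m h u) j"
proof -
  have len: "length D = 4 + d + m + Suc d * m ^ d" by (simp add: D_def length_query_table)
  show "load D 0 = real N" "load D 1 = \<Delta>" "load D 2 = h" "load D 3 = real m"
    using load_of_nat[of 0 D] load_of_nat[of 1 D] load_of_nat[of 2 D] load_of_nat[of 3 D] len
    by (auto simp: D_def query_table_def nth_append nth_Cons numeral_2_eq_2 numeral_3_eq_3)
  show "load D (real (4 + j)) = x0 j" if "j < d" for j
    using load_of_nat[of "4 + j" D] len that by (simp add: D_def query_table_def nth_append)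
  show "load D (real (4 + d) + t) = real (nat \<lfloor>t\<rfloor>)" if "0 \<le> t" "t < real m" for t
  proof -
    have lt: "nat \<lfloor>t\<rfloor> < m" using that by linarith
    then have "load D (real (4 + d) + t) = D ! (4 + d + nat \<lfloor>t\<rfloor>)"
      by (intro load_add) (use that len in auto)
    also have "\<dots> = real (nat \<lfloor>t\<rfloor>)" using lt by (simp add: D_def query_table_def nth_append)
    finally show ?thesis .
  qed
  \<comment> \<open>The bound \<open>r \<le> d\<close> makes \<open>u\<close> and \<open>r\<close>
    the quotient and remainder modulo \<open>Suc d\<close>, which is how the entries are laid
    out.\<close>
  have entry: "load D (real (4 + d + m + Suc d * u + r)) = (case r of 0 \<Rightarrow> q (table_point m h u)
      | Suc j \<Rightarrow> \<zeta> (table_point m h u) j)" if "u < m ^ d" "r \<le> d" for u r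
  proof -
    have "Suc d * u + r < Suc d * Suc u" using that by simp
    also have "\<dots> \<le> Suc d * m ^ d" using that by (intro mult_left_mono) auto
    finally have lt: "Suc d * u + r < Suc d * m ^ d" .
    have dm: "(Suc d * u + r) div Suc d = u" "(Suc d * u + r) mod Suc d = r"
      using that by (simp_all only: div_mult_self4 mod_mult_self4) (simp_all add: div_less)
    have "load D (real (4 + d + m + w)) = (case w mod Suc d of 0 \<Rightarrow> q (table_point m h (w div Suc d))
          | Suc j \<Rightarrow> \<zeta> (table_point m h (w div Suc d)) j)" if "w < Suc d * m ^ d" for w
    proof -
      have "load D (real (4 + d + m + w)) = D ! (4 + d + m + w)"
        using that len by (intro load_of_nat) simp
      also have "\<dots> = (case w mod Suc d of 0 \<Rightarrow> q (table_point m h (w div Suc d))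
          | Suc j \<Rightarrow> \<zeta> (table_point m h (w div Suc d)) j)"
        using that by (simp add: D_def query_table_def nth_append del: mult_Suc split: nat.split)
      finally show ?thesis .
    qed
    from this[OF lt] show ?thesis unfolding dm by (simp only: add.assoc)
  qed
  show "load D (real (4 + d + m + Suc d * u)) = q (table_point m h u)" if "u < m ^ d" for u
    using entry[OF that, of 0] by simp
  show "load D (real (4 + d + m + Suc d * u + Suc j)) = \<zeta> (table_point m h u) j"
    if "u < m ^ d" "j < d" for u j
    using entry[of u "Suc j"] that by simp
qed

lemma hom_mat_cong:
  "(\<And>i j. i \<le> d \<Longrightarrow> j < d \<Longrightarrow> v i j = w i j) \<Longrightarrow> hom_mat d v = hom_mat d w"
  by (auto simp: hom_mat_def intro!: eq_matI)

lemma in_simplex_cong: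
  assumes "\<And>i j. i \<le> d \<Longrightarrow> j < d \<Longrightarrow> v i j = w i j"
  shows "in_simplex d v p = in_simplex d w p"
proof -
  have "(\<Sum>i\<le>d. l i * v i j) = (\<Sum>i\<le>d. l i * w i j)" if "j < d" for l j
    using that assms by (intro sum.cong) auto
  then show ?thesis unfolding in_simplex_def by (auto intro!: ex_cong1)
qed

lemma ball_in_simplex_cong:
  assumes "\<And>i j. i \<le> d \<Longrightarrow> j < d \<Longrightarrow> v i j = w i j"
  shows "ball_in_simplex d v q \<rho> = ball_in_simplex d w q \<rho>"
  unfolding ball_in_simplex_def using in_simplex_cong[of d v w, OF assms] by simp

lemma abs_le_L2_set_diff:
  fixes j d :: nat
  shows "j < d \<Longrightarrow> \<bar>p j - q j\<bar> \<le> L2_set (\<lambda>j. p j - q j) {..<d}"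
  using member_le_L2_set[of "{..<d}" j "\<lambda>j. \<bar>p j - q j\<bar>"] by (simp add: L2_set_def)

text \<open>The ball lies in the box [-3,3]^d. For a point \<open>p\<close> of the box the
  coordinates \<open>(p i + 3) / (6 * real d)\<close> are nonnegative with sum at most 1; the
  remainder belongs to the corner, which is vertex \<open>d\<close>.\<close>

lemma ball_in_initial_simplex:
  assumes "0 < d" "\<rho> \<le> 1" "\<And>j. j < d \<Longrightarrow> \<bar>q j\<bar> \<le> 2"
  shows "ball_in_simplex d (\<lambda>i j. - 3 + (if i = j then 6 * real d else 0)) q \<rho>"
  unfolding ball_in_simplex_def
proof (intro allI impI)
  fix p assume p: "L2_set (\<lambda>j. p j - q j) {..<d} \<le> \<rho>"
  have p3: "\<bar>p j\<bar> \<le> 3" if "j < d" for j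
    using abs_le_L2_set_diff[OF that, of p q] p assms(2) assms(3)[OF that] by linarith
  define l where "l i = (if i < d then (p i + 3) / (6 * real d) else 1 - (\<Sum>j<d. (p j + 3) / (6 * real d)))" for i
  have "(\<Sum>j<d. (p j + 3) / (6 * real d)) \<le> (\<Sum>j<d. 6 / (6 * real d))"
    using p3 by (intro sum_mono divide_right_mono) (auto simp: abs_le_iff)
  also have "\<dots> = 1" using assms(1) by simp
  finally have "0 \<le> l i" if "i \<le> d" for i
    using that p3[of i] by (auto simp: l_def abs_le_iff)
  moreover have s1: "(\<Sum>i\<le>d. l i) = 1"
    by (simp add: l_def flip: lessThan_Suc_atMost)
  moreover have "p j = (\<Sum>i\<le>d. l i * (- 3 + (if i = j then 6 * real d else 0)))" if "j < d" for j
  proof -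
    have "(\<Sum>i\<le>d. l i * (- 3 + (if i = j then 6 * real d else 0)))
        = (\<Sum>i\<le>d. l i * (- 3)) + (\<Sum>i\<le>d. if i = j then l j * (6 * real d) else 0)"
      unfolding sum.distrib[symmetric] by (intro sum.cong) (auto simp: algebra_simps)
    also have "(\<Sum>i\<le>d. l i * (- 3)) = - 3" by (simp only: s1 flip: sum_distrib_right)
    also have "(\<Sum>i\<le>d. if i = j then l j * (6 * real d) else 0) = l j * (6 * real d)"
      using that by simp
    finally show ?thesis using that assms(1) by (simp add: l_def)
  qed
  ultimately show "in_simplex d (\<lambda>i j. - 3 + (if i = j then 6 * real d else 0)) p"
    unfolding in_simplex_def by blast
qed

section \<open>Correctness and cost of queries\<close>

lemma sum_basis_list:
  fixes f :: "'a::euclidean_space \<Rightarrow> real"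
  shows "(\<Sum>b\<in>Basis. f b) = (\<Sum>j<DIM('a). f (basis_list ! j))"
    and "j < DIM('a) \<Longrightarrow> (basis_list ! j :: 'a) \<in> Basis"
    and "j < DIM('a) \<Longrightarrow> i < DIM('a) \<Longrightarrow> (basis_list ! i = (basis_list ! j :: 'a)) \<longleftrightarrow> i = j"
proof -
  have "\<exists>l. distinct l \<and> set l = (Basis :: 'a set)"
    using finite_distinct_list[of "Basis :: 'a set"] by auto
  then have l: "distinct (basis_list :: 'a list)" "set (basis_list :: 'a list) = Basis"
    unfolding basis_list_def by (metis (mono_tags, lifting) someI_ex)+
  then have len: "length (basis_list :: 'a list) = DIM('a)"
    by (metis distinct_card)
  have "bij_betw (\<lambda>j. (basis_list :: 'a list) ! j) {..<DIM('a)} Basis"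
    using bij_betw_nth[OF l(1)] l(2) len by metis
  then show "(\<Sum>b\<in>Basis. f b) = (\<Sum>j<DIM('a). f (basis_list ! j))"
    by (rule sum.reindex_bij_betw[symmetric])
  show "j < DIM('a) \<Longrightarrow> (basis_list ! j :: 'a) \<in> Basis"
    using l(2) len nth_mem by metis
  show "j < DIM('a) \<Longrightarrow> i < DIM('a) \<Longrightarrow> (basis_list ! i = (basis_list ! j :: 'a)) \<longleftrightarrow> i = j"
    using l(1) len nth_eq_iff_index_eq by metis
qed

definition coord :: "'a::euclidean_space \<Rightarrow> nat \<Rightarrow> real" where
  "coord x j = x \<bullet> basis_list ! j"

definition of_coords :: "(nat \<Rightarrow> real) \<Rightarrow> 'a::euclidean_space" where
  "of_coords p = (\<Sum>j<DIM('a). p j *\<^sub>R basis_list ! j)"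

lemma inner_eq_sum_coord:
  fixes x y :: "'a::euclidean_space"
  shows "x \<bullet> y = (\<Sum>j<DIM('a). coord x j * coord y j)"
  by (simp add: euclidean_inner[of x y] sum_basis_list(1) coord_def)

lemma norm_eq_L2_set_coord:
  fixes x :: "'a::euclidean_space"
  shows "norm x = L2_set (coord x) {..<DIM('a)}"
  by (simp add: norm_eq_sqrt_inner inner_eq_sum_coord L2_set_def power2_eq_square)

lemma coord_of_coords:
  "j < DIM('a) \<Longrightarrow> coord (of_coords p :: 'a::euclidean_space) j = p j"
  by (simp add: coord_def of_coords_def inner_sum_left inner_Basis sum_basis_list(2,3) if_distrib
      sum.delta' cong: if_cong)

lemma coord_diff: "coord (x - y) j = coord x j - coord y j"
  by (simp add: coord_def inner_diff_left)

text \<open>The conclusion of \<open>conjugate_first_order\<close> in coordinates, at the single point \<open>y\<close> with value \<open>F\<close>.\<close>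

definition first_order_model :: "nat \<Rightarrow> ((nat \<Rightarrow> real) \<Rightarrow> real) \<Rightarrow> ((nat \<Rightarrow> real) \<Rightarrow> nat \<Rightarrow> real)
    \<Rightarrow> (nat \<Rightarrow> real) \<Rightarrow> real \<Rightarrow> (nat \<Rightarrow> real) \<Rightarrow> bool" where
  "first_order_model d q \<zeta> y F p' \<longleftrightarrow>
     (\<forall>g. L2_set (\<lambda>j. y j - \<zeta> g j) {..<d} \<le> 1) \<and>
     (\<forall>p. (\<Sum>j<d. p j * y j) - q p \<le> F) \<and>
     (\<forall>p g. (\<Sum>j<d. p j * y j) - q p \<le> (\<Sum>j<d. g j * y j) - q g + (\<Sum>j<d. (p j - g j) * (y j - \<zeta> g j))) \<and>
     (\<forall>j<d. \<bar>p' j\<bar> \<le> 2) \<and>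
     (\<forall>p. (\<Sum>j<d. p j * y j) - q p \<ge> F - (L2_set (\<lambda>j. p j - p' j) {..<d})\<^sup>2 / 2)"

text \<open>Success, the first alternative, persists because \<open>Best\<close> never decreases,
  and from then on the simplex may be arbitrary. Before success the ball is kept while the
  determinant decays geometrically from its initial value \<open>(6 * real d) ^ d\<close>.\<close>

definition query_inv :: "nat \<Rightarrow> real \<Rightarrow> real \<Rightarrow> nat \<Rightarrow> nat \<Rightarrow> real \<Rightarrow> (nat \<Rightarrow> real) \<Rightarrow> real \<Rightarrow> (nat \<Rightarrow> real)
    \<Rightarrow> nat \<Rightarrow> (var \<Rightarrow> real) \<Rightarrow> bool" where
  "query_inv d \<rho> h m N \<Delta> y F p' t \<sigma> \<longleftrightarrow>
     \<sigma> Mesh = h \<and> \<sigma> Side = real m \<and> \<sigma> Iters = real N \<and> \<sigma> Scale = \<Delta> \<and> \<sigma> Count = real t \<and>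
     (\<forall>j<d. \<sigma> (Coord j) = y j) \<and> \<sigma> Best \<le> F \<and>
     (F - \<rho>\<^sup>2 / 2 \<le> \<sigma> Best \<or> ball_in_simplex d (\<lambda>i j. \<sigma> (Vert i j)) p' \<rho> \<and>
        (1 + cut_rate d / 4) ^ t * \<bar>hom_det d (\<lambda>i j. \<sigma> (Vert i j))\<bar> \<le> (6 * real d) ^ d)"

lemma query_inv_step:
  assumes h: "h = \<rho> / (4 * real d * (real d + 1))" and D: "D = query_table d N \<Delta> h m x0 q \<zeta>"
    and d: "0 < d" and \<rho>: "0 < \<rho>" "\<rho> \<le> 1" and m: "6 / h < real m"
    and model: "first_order_model d q \<zeta> y F p'" and inv: "query_inv d \<rho> h m N \<Delta> y F p' t \<sigma>"
  shows "query_inv d \<rho> h m N \<Delta> y F p' (Suc t) (exec_asgs D (query_body d) \<sigma>)"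
proof -
  define \<tau> where "\<tau> = exec_asgs D (query_body d) \<sigma>"
  note spec = query_body_spec[where d = d and D = D and \<sigma> = \<sigma>, folded \<tau>_def]
  have h0: "h > 0" using d \<rho> by (simp add: h)
  have \<sigma>: "\<sigma> Mesh = h" "\<sigma> Side = real m" "\<sigma> Iters = real N" "\<sigma> Scale = \<Delta>" "\<sigma> Count = real t"
    "\<And>j. j < d \<Longrightarrow> \<sigma> (Coord j) = y j" "\<sigma> Best \<le> F"
    using inv by (auto simp: query_inv_def)
  have orc: "\<And>g. L2_set (\<lambda>j. y j - \<zeta> g j) {..<d} \<le> 1" "\<And>p. (\<Sum>j<d. p j * y j) - q p \<le> F"
    "\<And>p g. (\<Sum>j<d. p j * y j) - q p \<le> (\<Sum>j<d. g j * y j) - q g + (\<Sum>j<d. (p j - g j) * (y j - \<zeta> g j))"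
    "\<And>j. j < d \<Longrightarrow> \<bar>p' j\<bar> \<le> 2"
    "\<And>p. (\<Sum>j<d. p j * y j) - q p \<ge> F - (L2_set (\<lambda>j. p j - p' j) {..<d})\<^sup>2 / 2"
    using model unfolding first_order_model_def by auto
  define s where "s j = (\<tau> (Clamp j) + 3) / h" for j
  define k where "k j = nat \<lfloor>s j\<rfloor>" for j
  define u where "u = (\<Sum>j<d. k j * m ^ j)"
  define g where "g = table_point m h u"
  \<comment> \<open>The strict inequality in \<open>m\<close> keeps the index below \<open>m\<close>
    even for a coordinate clamped to 3.\<close>
  have s: "0 \<le> s j" "s j < real m" if "j < d" for j
  proof -
    have "-3 \<le> \<tau> (Clamp j)" "\<tau> (Clamp j) \<le> 3" using spec(4)[OF that] by auto
    then show "0 \<le> s j" using h0 by (simp add: s_def)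
    have "s j \<le> 6 / h" unfolding s_def using h0 \<open>\<tau> (Clamp j) \<le> 3\<close> by (intro divide_right_mono) auto
    then show "s j < real m" using m by simp
  qed
  have km: "k j < m" if "j < d" for j using s[OF that] unfolding k_def by linarith
  have idx: "\<tau> (Idx j) = real (k j)" if "j < d" for j
    using spec(5)[OF that] load_query_table(6)[where d = d and N = N and \<Delta> = \<Delta> and h = h and m = m and ?x0.0 = x0 and q = q and \<zeta> = \<zeta>, OF s[OF that]]
    by (simp add: k_def s_def D \<sigma>)
  have u: "u < m ^ d" unfolding u_def using km by (intro sum_digits_less)
  have gj: "g j = h * real (k j) - 3" if "j < d" for j
    using digit_of_sum_digits[of d k m j] km that by (simp add: g_def table_point_def u_def)
  have grid: "\<tau> (Grid j) = g j" if "j < d" for j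
    using spec(6)[OF that] idx[OF that] gj[OF that] by (simp add: \<sigma>)
  have close: "\<bar>\<tau> (Clamp j) - g j\<bar> \<le> h" if "j < d" for j
  proof -
    have "\<tau> (Clamp j) = h * s j - 3" using h0 by (simp add: s_def)
    then have "\<tau> (Clamp j) - g j = h * (s j - real (k j))" using gj[OF that] by (simp add: algebra_simps)
    moreover have "0 \<le> s j - real (k j)" "s j - real (k j) \<le> 1" using s[OF that] unfolding k_def by linarith+
    ultimately show ?thesis using h0 by (simp add: mult_left_le)
  qed
  have code: "\<tau> Code = real (4 + d + m + Suc d * u)"
  proof -
    have "(\<Sum>j<d. \<tau> (Idx j) * real m ^ j) = real u"
      unfolding u_def by (simp add: idx)
    then show ?thesis using spec(7) by (simp add: \<sigma> distrib_right)
  qed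
  have conj: "\<tau> Conj = q g"
    using spec(8) load_query_table(7)[where d = d and N = N and \<Delta> = \<Delta> and h = h and m = m and ?x0.0 = x0 and q = q and \<zeta> = \<zeta>, OF u] unfolding code D g_def by simp
  have arg: "\<tau> (Arg j) = \<zeta> g j" if "j < d" for j
    using spec(9)[OF that] load_query_table(8)[where d = d and N = N and \<Delta> = \<Delta> and h = h and m = m and ?x0.0 = x0 and q = q and \<zeta> = \<zeta>, OF u that]
    unfolding code D g_def of_nat_add[symmetric] by simp
  have best: "\<tau> Best = max (\<sigma> Best) ((\<Sum>j<d. g j * y j) - q g)"
    using spec(10) by (simp add: conj grid \<sigma>)
  have frame: "\<tau> Mesh = h" "\<tau> Side = real m" "\<tau> Iters = real N" "\<tau> Scale = \<Delta>" "\<tau> Count = real (Suc t)"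
    "\<And>j. j < d \<Longrightarrow> \<tau> (Coord j) = y j"
    using spec(1)[of Mesh] spec(1)[of Side] spec(1)[of Iters] spec(1)[of Scale] spec(2) spec(1)[of "Coord _"] \<sigma> by auto
  have "F - \<rho>\<^sup>2 / 2 \<le> \<tau> Best \<or> ball_in_simplex d (\<lambda>i j. \<tau> (Vert i j)) p' \<rho> \<and>
        (1 + cut_rate d / 4) ^ Suc t * \<bar>hom_det d (\<lambda>i j. \<tau> (Vert i j))\<bar> \<le> (6 * real d) ^ d"
  proof (cases "F - \<rho>\<^sup>2 / 2 \<le> \<tau> Best")
    case False
    then have ball: "ball_in_simplex d (\<lambda>i j. \<sigma> (Vert i j)) p' \<rho>"
      and det: "(1 + cut_rate d / 4) ^ t * \<bar>hom_det d (\<lambda>i j. \<sigma> (Vert i j))\<bar> \<le> (6 * real d) ^ d"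
      using inv unfolding query_inv_def best by auto
    have worse: "(\<Sum>j<d. g j * y j) - q g < F - \<rho>\<^sup>2 / 2" using False unfolding best by auto
    \<comment> \<open>On the ball the dual value is at least \<open>F - \<rho>\<^sup>2 / 2\<close>,
      at \<open>g\<close> it is smaller; the first-order bound at \<open>g\<close> turns this gap
      into the sign of the cut.\<close>
    have better: "0 < (\<Sum>j<d. (p j - g j) * (y j - \<zeta> g j))"
      if "L2_set (\<lambda>j. p j - p' j) {..<d} \<le> \<rho>" for p
    proof -
      have "(L2_set (\<lambda>j. p j - p' j) {..<d})\<^sup>2 \<le> \<rho>\<^sup>2" using that by (intro power_mono) auto
      then show ?thesis using worse orc(5)[of p] orc(3)[of p g] by linarith
    qed
    obtain k where k: "k \<le> d" "\<And>i. i \<le> d \<Longrightarrow> \<tau> (Cut i) \<le> \<tau> (Cut k)"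
      "\<And>i j. i \<le> d \<Longrightarrow> j < d \<Longrightarrow> \<tau> (Vert i j) =
         cut_vertex (cut_rate d) (\<lambda>i. \<tau> (Cut i)) k (\<lambda>i j. \<sigma> (Vert i j)) i j"
      using spec(13) by blast
    have c: "\<tau> (Cut i) = (\<Sum>j<d. (y j - \<zeta> g j) * (\<sigma> (Vert i j) - g j))
          + 2 * (\<Sum>j<d. (\<tau> (Clamp j) - \<tau> (Cent j)) * (\<sigma> (Vert i j) - \<tau> (Clamp j))) / \<tau> Dist"
      if "i \<le> d" for i
      using spec(12)[OF that] by (simp add: \<sigma> arg grid)
    have hd: "4 * real d * (real d + 1) * h \<le> \<rho>" using d by (simp add: h)
    note cs = cutting_step[where y = y and z = "\<zeta> g" and pg = g and pc = "\<lambda>j. \<tau> (Clamp j)"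
        and ce = "\<lambda>j. \<tau> (Cent j)" and q = p' and c = "\<lambda>i. \<tau> (Cut i)" and v = "\<lambda>i j. \<sigma> (Vert i j)"
        and \<theta> = "cut_rate d", OF \<rho> hd orc(1) spec(3) spec(4) close spec(11) c k(1,2) orc(4) ball better cut_rate_def]
    have "ball_in_simplex d (\<lambda>i j. \<tau> (Vert i j)) p' \<rho>"
      using cs(1) ball_in_simplex_cong[of d "\<lambda>i j. \<tau> (Vert i j)", OF k(3)] by simp
    moreover have "(1 + cut_rate d / 4) ^ Suc t * \<bar>hom_det d (\<lambda>i j. \<tau> (Vert i j))\<bar>
        \<le> (1 + cut_rate d / 4) ^ t * \<bar>hom_det d (\<lambda>i j. \<sigma> (Vert i j))\<bar>"
      unfolding power_Suc2 mult.assoc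
      using cs(2) hom_mat_cong[of d "\<lambda>i j. \<tau> (Vert i j)", OF k(3)]
      by (intro mult_left_mono) (auto simp: cut_rate_def)
    ultimately show ?thesis using det by simp
  qed simp
  moreover have "\<tau> Best \<le> F" using \<sigma>(7) orc(2)[of g] unfolding best by simp
  ultimately show ?thesis unfolding \<tau>_def[symmetric] query_inv_def using frame by auto
qed

lemma query_init_spec:
  fixes d D \<sigma>
  defines "\<tau> \<equiv> exec_asgs D (query_init d) \<sigma>"
  shows "\<tau> Iters = load D 0" "\<tau> Scale = load D 1" "\<tau> Mesh = load D 2" "\<tau> Side = load D 3"
    and "\<tau> Count = 0" "\<tau> Best = -1"
    and "\<And>j. j < d \<Longrightarrow> \<tau> (Coord j) = (\<sigma> (Inp j) - load D (real (4 + j))) / load D 1"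
    and "\<And>i j. i \<le> d \<Longrightarrow> j < d \<Longrightarrow> \<tau> (Vert i j) = - 3 + (if i = j then 6 * real d else 0)"
proof -
  define s1 where "s1 = \<sigma>(Iters := load D 0, Scale := load D 1, Mesh := load D 2, Side := load D 3,
     Count := 0, Best := -1)"
  define s2 where "s2 = exec_asgs D (family Coord (\<lambda>j. Divide (Minus (Var (Inp j)) (Fetch (Num (real (4 + j)))))
     (Var Scale)) [0..<d]) s1"
  define s3 where "s3 = exec_asgs D (family (\<lambda>(i, j). Vert i j)
     (\<lambda>(i, j). Num (- 3 + (if i = j then 6 * real d else 0))) (vertex_pairs d)) s2"
  have \<tau>: "\<tau> = s3"
    unfolding \<tau>_def query_init_def s3_def s2_def s1_def fold_append o_apply by (simp add: exec_asg_def)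
  have f2: "s2 x = s1 x" if "x \<notin> range Coord" for x
    unfolding s2_def by (rule exec_family_frame) (use that in auto)
  have f3: "s3 x = s2 x" if "x \<notin> range (\<lambda>(i, j). Vert i j)" for x
    unfolding s3_def by (rule exec_family_frame) (use that in auto)
  have e2: "s2 (Coord j) = (s1 (Inp j) - load D (real (4 + j))) / s1 Scale" if "j < d" for j
    unfolding s2_def by (subst exec_family) (use that in \<open>auto simp: inj_on_def\<close>)
  show "\<tau> Iters = load D 0" "\<tau> Scale = load D 1" "\<tau> Mesh = load D 2" "\<tau> Side = load D 3"
    "\<tau> Count = 0" "\<tau> Best = -1"
    by (simp_all add: \<tau> f2 f3 image_iff split_paired_Ex) (simp_all add: s1_def)
  show "\<tau> (Coord j) = (\<sigma> (Inp j) - load D (real (4 + j))) / load D 1" if "j < d" for j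
    using e2[OF that] by (simp add: \<tau> f3 image_iff split_paired_Ex) (simp add: s1_def)
  show "\<tau> (Vert i j) = - 3 + (if i = j then 6 * real d else 0)" if "i \<le> d" "j < d" for i j
    unfolding \<tau> s3_def
    by (subst exec_family[where A = "\<lambda>(i, j). Vert i j" and i = "(i, j)", unfolded prod.case])
      (use that in \<open>auto simp: inj_on_def distinct_product simp del: upt_Suc\<close>)
qed

definition query_program :: "nat \<Rightarrow> instr list" where
  "query_program d = loop_program d (query_init d) (query_body d) Count Iters (query_final d) Res"

definition query_time :: "nat \<Rightarrow> nat \<Rightarrow> nat" where
  "query_time d N = length (compile d (query_init d)) + Suc N * Suc (length (compile d (query_body d)))
     + length (compile d (query_final d))"

text \<open>If all \<open>Suc N\<close> passes failed, the final simplex would contain a ball of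
  radius \<rho> although its determinant has become too small for that; assumption \<open>N\<close>
  expresses this contradiction. So \<open>Best\<close> ends within \<open>\<rho>\<^sup>2 / 2\<close>
  below \<open>F\<close>.\<close>

lemma query_program_halts:
  fixes x :: "'a::euclidean_space"
  assumes d: "d = DIM('a)" and h: "h = \<rho> / (4 * real d * (real d + 1))"
    and D: "D = query_table d N \<Delta> h m x0 q \<zeta>"
    and \<rho>: "0 < \<rho>" "\<rho> \<le> 1" and m: "6 / h < real m" and \<Delta>: "0 < \<Delta>"
    and y: "\<And>j. j < d \<Longrightarrow> y j = (coord x j - x0 j) / \<Delta>"
    and model: "first_order_model d q \<zeta> y F p'" and F: "-1 \<le> F"
    and N: "fact (Suc d) * (6 * real d) ^ d < (1 + cut_rate d / 4) ^ Suc N * \<rho> ^ d"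
  obtains r where "halts_with (query_program d) D x (query_time d N) r"
    "\<bar>r - \<Delta> * ((L2_set y {..<d})\<^sup>2 / 2 - F)\<bar> \<le> \<Delta> * \<rho>\<^sup>2"
proof -
  have d0: "0 < d" by (simp add: d)
  define \<sigma>0 where "\<sigma>0 v = (case v of Inp j \<Rightarrow> if j < d then coord x j else 0 | _ \<Rightarrow> 0)" for v
  define \<sigma> where "\<sigma> t = (exec_asgs D (query_body d) ^^ t) (exec_asgs D (query_init d) \<sigma>0)" for t
  note tab = load_query_table[where d = d and N = N and \<Delta> = \<Delta> and h = h and m = m
      and ?x0.0 = x0 and q = q and \<zeta> = \<zeta>, folded D]
  note ini = query_init_spec[where d = d and D = D and \<sigma> = \<sigma>0]
  have p': "\<And>j. j < d \<Longrightarrow> \<bar>p' j\<bar> \<le> 2" using model by (simp add: first_order_model_def)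
  have v0: "\<sigma> 0 (Vert i j) = - 3 + (if i = j then 6 * real d else 0)" if "i \<le> d" "j < d" for i j
    using ini(8)[OF that] by (simp add: \<sigma>_def)
  have inv: "query_inv d \<rho> h m N \<Delta> y F p' t (\<sigma> t)" for t
  proof (induction t)
    case 0
    have "ball_in_simplex d (\<lambda>i j. \<sigma> 0 (Vert i j)) p' \<rho>"
      using ball_in_simplex_cong[of d "\<lambda>i j. \<sigma> 0 (Vert i j)", OF v0]
        ball_in_initial_simplex[OF d0 \<rho>(2) p'] by simp
    moreover have "hom_det d (\<lambda>i j. \<sigma> 0 (Vert i j)) = (6 * real d) ^ d"
      using hom_mat_cong[of d "\<lambda>i j. \<sigma> 0 (Vert i j)" "\<lambda>i j. - 3 + (if i = j then 6 * real d else 0)"]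
        hom_det_corner[of d "\<lambda>_. -3" "6 * real d"] by (simp add: v0)
    moreover have "\<sigma> 0 (Coord j) = y j" if "j < d" for j
      using ini(7)[OF that] tab(2) tab(5)[OF that] y[OF that] that by (simp add: \<sigma>_def \<sigma>0_def)
    ultimately show ?case
      using F by (simp add: query_inv_def) (simp add: \<sigma>_def ini tab)
  next
    case (Suc t)
    then show ?case
      using query_inv_step[OF h D d0 \<rho> m model] by (simp add: \<sigma>_def)
  qed
  have count: "\<sigma> t Count = real t" "\<sigma> t Iters = real N" "\<sigma> t Scale = \<Delta>" for t
    using inv[of t] by (auto simp: query_inv_def)
  define r where "r = exec_asgs D (query_final d) (\<sigma> (Suc N)) Res"
  have "halts_with (query_program d) D x (query_time d N) r"
    unfolding query_program_def query_time_def r_def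
  proof (rule loop_program_halts[OF d, where start = \<sigma>0])
    show "\<sigma>0 (Inp j) = x \<bullet> basis_list ! j" if "j < d" for j
      using that by (simp add: \<sigma>0_def coord_def)
    show "\<sigma>0 v = 0" if "\<And>j. j < d \<Longrightarrow> v \<noteq> Inp j" for v
      using that by (auto simp: \<sigma>0_def split: var.split)
    show "\<sigma> 0 = exec_asgs D (query_init d) \<sigma>0" "\<sigma> (Suc t) = exec_asgs D (query_body d) (\<sigma> t)" for t
      by (simp_all add: \<sigma>_def)
    show "\<sigma> t Count \<le> \<sigma> t Iters" if "0 < t" "t \<le> N" for t
      using that by (simp add: count)
    show "\<sigma> (Suc N) Iters < \<sigma> (Suc N) Count" by (simp add: count)
  qed
  moreover have "\<bar>r - \<Delta> * ((L2_set y {..<d})\<^sup>2 / 2 - F)\<bar> \<le> \<Delta> * \<rho>\<^sup>2"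
  proof -
    let ?s = "\<sigma> (Suc N)"
    have Y: "\<And>j. j < d \<Longrightarrow> ?s (Coord j) = y j" and up: "?s Best \<le> F"
      using inv[of "Suc N"] by (auto simp: query_inv_def)
    have low: "F - \<rho>\<^sup>2 / 2 \<le> ?s Best"
    proof (rule ccontr)
      assume "\<not> ?thesis"
      then have ball: "ball_in_simplex d (\<lambda>i j. ?s (Vert i j)) p' \<rho>"
        and det: "(1 + cut_rate d / 4) ^ Suc N * \<bar>hom_det d (\<lambda>i j. ?s (Vert i j))\<bar> \<le> (6 * real d) ^ d"
        using inv[of "Suc N"] by (auto simp: query_inv_def)
      have "(1 + cut_rate d / 4) ^ Suc N * \<rho> ^ d \<le> (1 + cut_rate d / 4) ^ Suc N *
          (fact (Suc d) * \<bar>hom_det d (\<lambda>i j. ?s (Vert i j))\<bar>)"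
        using ball_in_simplex_det_ge[OF ball] \<rho> by (intro mult_left_mono) (auto simp: cut_rate_def)
      also have "\<dots> = fact (Suc d) *
          ((1 + cut_rate d / 4) ^ Suc N * \<bar>hom_det d (\<lambda>i j. ?s (Vert i j))\<bar>)"
        by (simp only: mult.left_commute)
      also have "\<dots> \<le> fact (Suc d) * (6 * real d) ^ d"
        using det by (intro mult_left_mono) auto
      finally show False using N by simp
    qed
    have "r = \<Delta> * ((\<Sum>j<d. y j * y j) / 2 - ?s Best)"
      by (simp add: r_def query_final_def exec_asg_def count Y)
    also have "(\<Sum>j<d. y j * y j) = (L2_set y {..<d})\<^sup>2"
      unfolding L2_set_squared by (simp add: power2_eq_square)
    finally have "r - \<Delta> * ((L2_set y {..<d})\<^sup>2 / 2 - F) = \<Delta> * (F - ?s Best)"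
      by (simp add: algebra_simps)
    moreover have "\<bar>F - ?s Best\<bar> \<le> \<rho>\<^sup>2" using up low by simp
    ultimately show ?thesis using \<Delta> by (simp add: abs_mult)
  qed
  ultimately show thesis by (rule that)
qed

text \<open>Scaling divides values and displacements by the same \<Delta>, so supergradients remain
  unit vectors. An origin \<open>x0\<close> in \<Omega> makes the scaled query at most 1 in norm,
  hence \<open>norm p' \<le> 2\<close>. The order of quantifiers matters: \<open>q\<close> and
  \<open>\<zeta>\<close> are stored and must not depend on \<open>x\<close>, whereas
  \<open>p'\<close> does and is never computed.\<close>

lemma distance_first_order_model:
  fixes \<Omega> :: "'a::euclidean_space set"
  assumes "convex \<Omega>" "compact \<Omega>" "interior \<Omega> \<noteq> {}" and x0: "x0 \<in> \<Omega>"
    and \<Delta>: "\<Delta> = diameter \<Omega>" "0 < \<Delta>"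
  obtains q \<zeta> where "\<And>x. x \<in> \<Omega> \<Longrightarrow> \<exists>p'. first_order_model DIM('a) q \<zeta>
      (coord ((x - x0) /\<^sub>R \<Delta>)) ((norm ((x - x0) /\<^sub>R \<Delta>))\<^sup>2 / 2 - bdist \<Omega> x / \<Delta>) p'"
proof -
  define f where "f x = (x - x0) /\<^sub>R \<Delta>" for x
  define e where "e y = bdist \<Omega> (x0 + \<Delta> *\<^sub>R y) / \<Delta>" for y
  have inv: "x0 + \<Delta> *\<^sub>R f x = x" for x using \<Delta>(2) by (simp add: f_def)
  have ef: "e (f x) = bdist \<Omega> x / \<Delta>" for x by (simp add: e_def inv)
  have cont: "continuous_on (f ` \<Omega>) e"
    unfolding e_def bdist_def using \<Delta>(2) by (intro continuous_intros continuous_on_infdist) auto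
  have comp: "compact (f ` \<Omega>)"
    unfolding f_def by (intro compact_continuous_image continuous_intros assms(2))
  have super: "\<exists>a. norm a = 1 \<and> (\<forall>z\<in>f ` \<Omega>. e z \<le> e y + a \<bullet> (z - y))" if y: "y \<in> f ` \<Omega>" for y
  proof -
    obtain x where x: "x \<in> \<Omega>" "y = f x" using y by blast
    obtain a where a: "norm a = 1" "\<And>z. z \<in> \<Omega> \<Longrightarrow> bdist \<Omega> z \<le> bdist \<Omega> x + a \<bullet> (z - x)"
      using bdist_supergradient[OF assms(1-3) x(1)] by metis
    have "e (f z) \<le> e (f x) + a \<bullet> (f z - f x)" if "z \<in> \<Omega>" for z
    proof -
      have eq: "f z - f x = (z - x) /\<^sub>R \<Delta>" by (simp add: f_def algebra_simps)
      have "e (f z) \<le> (bdist \<Omega> x + a \<bullet> (z - x)) / \<Delta>"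
        unfolding ef using a(2)[OF that] \<Delta>(2) by (intro divide_right_mono) auto
      also have "\<dots> = e (f x) + a \<bullet> (f z - f x)"
        by (simp add: ef eq divide_inverse mult.commute distrib_left)
      finally show ?thesis .
    qed
    then show ?thesis using a(1) x(2) by auto
  qed
  have dist_le: "norm (f x - f z) \<le> 1" if "x \<in> \<Omega>" "z \<in> \<Omega>" for x z
  proof -
    have "f x - f z = (x - z) /\<^sub>R \<Delta>" by (simp add: f_def algebra_simps)
    moreover have "norm (x - z) \<le> \<Delta>"
      using diameter_bounded_bound[OF compact_imp_bounded[OF assms(2)] that] by (simp add: \<Delta> dist_norm)
    ultimately show ?thesis using \<Delta>(2) by (simp add: divide_simps)
  qed
  obtain q \<zeta> where q: "\<And>p. \<zeta> p \<in> f ` \<Omega>"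
    "\<And>p y. y \<in> f ` \<Omega> \<Longrightarrow> p \<bullet> y - q p \<le> (norm y)\<^sup>2 / 2 - e y"
    "\<And>p g y. p \<bullet> y - q p \<le> g \<bullet> y - q g + (p - g) \<bullet> (y - \<zeta> g)"
    "\<And>y. y \<in> f ` \<Omega> \<Longrightarrow> \<exists>p'. norm (p' - y) = 1 \<and>
        (\<forall>p. p \<bullet> y - q p \<ge> (norm y)\<^sup>2 / 2 - e y - (norm (p - p'))\<^sup>2 / 2)"
    using conjugate_first_order[OF comp _ cont super] x0 by (metis empty_iff image_is_empty)
  show thesis
  proof (rule that)
    fix x assume x: "x \<in> \<Omega>"
    then obtain p' where p': "norm (p' - f x) = 1"
      "\<And>p. p \<bullet> f x - q p \<ge> (norm (f x))\<^sup>2 / 2 - e (f x) - (norm (p - p'))\<^sup>2 / 2"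
      using q(4) by blast
    let ?d = "DIM('a)"
    define oc where "oc = (of_coords :: (nat \<Rightarrow> real) \<Rightarrow> 'a)"
    have ip: "(\<Sum>j<?d. p j * coord (f x) j) = oc p \<bullet> f x" for p
      unfolding inner_eq_sum_coord oc_def by (intro sum.cong) (auto simp: coord_of_coords)
    have dp: "(\<Sum>j<?d. (p j - g j) * (coord (f x) j - coord z j)) = (oc p - oc g) \<bullet> (f x - z)" for p g z
      unfolding inner_eq_sum_coord oc_def by (intro sum.cong) (auto simp: coord_of_coords coord_diff)
    have "norm p' \<le> norm (p' - f x) + norm (f x - f x0)"
      using norm_triangle_ineq[of "p' - f x" "f x"] by (simp add: f_def)
    then have "norm p' \<le> 2" using p'(1) dist_le[OF x x0] by simp
    then have "\<bar>coord p' j\<bar> \<le> 2" if "j < ?d" for j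
      using Basis_le_norm[OF sum_basis_list(2)[OF that], of p'] by (simp add: coord_def)
    moreover have "L2_set (\<lambda>j. coord (f x) j - coord (\<zeta> g) j) {..<?d} \<le> 1" for g
    proof -
      have "L2_set (\<lambda>j. coord (f x) j - coord (\<zeta> g) j) {..<?d} = norm (f x - \<zeta> g)"
        unfolding norm_eq_L2_set_coord by (intro L2_set_cong) (auto simp: coord_diff)
      then show ?thesis using q(1)[of g] dist_le[OF x] by auto
    qed
    moreover have "L2_set (\<lambda>j. p j - coord p' j) {..<?d} = norm (oc p - p')" for p
      unfolding norm_eq_L2_set_coord oc_def by (intro L2_set_cong) (auto simp: coord_diff coord_of_coords)
    ultimately show "\<exists>p'. first_order_model ?d (\<lambda>p. q (oc p)) (\<lambda>p. coord (\<zeta> (oc p)))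
      (coord ((x - x0) /\<^sub>R \<Delta>)) ((norm ((x - x0) /\<^sub>R \<Delta>))\<^sup>2 / 2 - bdist \<Omega> x / \<Delta>) p'"
      unfolding f_def[symmetric] ef[symmetric] first_order_model_def using q(2,3) p'(2) x
      by (intro exI[of _ "coord p'"]) (simp add: ip dp)
  qed
qed

section \<open>Number of passes and size of the table\<close>

lemma half_le_ln:
  fixes \<epsilon> :: real
  assumes "0 < \<epsilon>"
  shows "1/2 \<le> ln (2 + 1 / \<epsilon>)"
proof -
  have "0 < 1 / \<epsilon>" using assms by simp
  then have "ln 2 \<le> ln (2 + 1 / \<epsilon>)" by (subst ln_le_cancel_iff) linarith+
  then show ?thesis using ln2_ge_two_thirds by linarith
qed

text \<open>Take logarithms: \<open>Suc N * ln \<kappa>\<close> has to exceed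
  \<open>ln A - d * ln \<rho>\<close>, and \<open>- ln \<rho>\<close> is half of
  \<open>ln (1 + 1 / \<epsilon>)\<close>. The constant \<open>ln A\<close> is absorbed by the factor
  \<open>2 * ln (2 + 1 / \<epsilon>)\<close>, which is at least 1 even for large \<epsilon>.\<close>

lemma query_iterations_suffice:
  assumes A: "1 \<le> A" and \<kappa>: "1 < \<kappa>" and "0 < \<epsilon>"
    and \<rho>: "\<rho> = (1 + 1 / \<epsilon>) powr (- 1 / 2)"
    and N: "(2 * ln A + real d) / ln \<kappa> * ln (2 + 1 / \<epsilon>) \<le> real N"
  shows "A < \<kappa> ^ Suc N * \<rho> ^ d"
proof -
  have base: "0 < 1 + 1 / \<epsilon>" using \<open>0 < \<epsilon>\<close> by (intro add_pos_pos) auto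
  then have \<rho>0: "0 < \<rho>" by (simp add: \<rho> del: add_pos_pos)
  have W: "1/2 \<le> ln (2 + 1 / \<epsilon>)"
    using half_le_ln \<open>0 < \<epsilon>\<close> .
  have lr: "- ln \<rho> \<le> ln (2 + 1 / \<epsilon>) / 2"
  proof -
    have "- ln \<rho> = ln (1 + 1 / \<epsilon>) / 2" using base by (simp add: \<rho> ln_powr)
    also have "\<dots> \<le> ln (2 + 1 / \<epsilon>) / 2" using base by simp
    finally show ?thesis .
  qed
  have lnA: "0 \<le> ln A" using A by simp
  have l\<kappa>: "0 < ln \<kappa>" using \<kappa> by simp
  have "ln A - real d * ln \<rho> \<le> ln A + real d * (ln (2 + 1 / \<epsilon>) / 2)"
    using mult_left_mono[OF lr, of "real d"] by simp
  also have "\<dots> \<le> 2 * ln (2 + 1 / \<epsilon>) * ln A + real d * ln (2 + 1 / \<epsilon>)"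
  proof -
    have "1 * ln A \<le> 2 * ln (2 + 1 / \<epsilon>) * ln A" using W lnA by (intro mult_right_mono) auto
    moreover have "real d * (ln (2 + 1 / \<epsilon>) / 2) \<le> real d * ln (2 + 1 / \<epsilon>)" using W by (intro mult_left_mono) auto
    ultimately show ?thesis by simp
  qed
  also have "\<dots> = ((2 * ln A + real d) / ln \<kappa> * ln (2 + 1 / \<epsilon>)) * ln \<kappa>"
    using l\<kappa> by (simp add: field_simps)
  also have "\<dots> \<le> real N * ln \<kappa>" using N l\<kappa> by (intro mult_right_mono) auto
  also have "\<dots> < real (Suc N) * ln \<kappa>" using l\<kappa> by simp
  finally have "ln A < real (Suc N) * ln \<kappa> + real d * ln \<rho>" by simp
  also have "\<dots> = ln (\<kappa> ^ Suc N * \<rho> ^ d)"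
    using \<kappa> \<rho>0 by (simp add: ln_mult ln_realpow del: power_Suc)
  finally show ?thesis using A \<kappa> \<rho>0 by (subst (asm) ln_less_cancel_iff) auto
qed

text \<open>Since \<open>m\<close> and \<open>d\<close> are at least 1, header, index list and rows
  are at most \<open>4 + d\<close>, 1 and \<open>Suc d\<close> times \<open>m ^ d\<close>, which
  gives the factor \<open>2 * d + 6\<close>. As \<open>h \<le> 1\<close>, the rounding in
  \<open>m\<close> is absorbed by passing from \<open>6 / h\<close> to \<open>7 / h\<close>.\<close>

lemma query_table_size:
  assumes d: "0 < d" and \<rho>: "0 < \<rho>" "\<rho> \<le> 1" and h: "h = \<rho> / (4 * real d * (real d + 1))"
    and m: "m = nat \<lfloor>6 / h\<rfloor> + 1"
  shows "real (4 + d + m + Suc d * m ^ d) \<le>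
    (2 * real d + 6) * (28 * real d * (real d + 1)) ^ d * (1 / \<rho>) ^ d"
proof -
  have h0: "0 < h" using d \<rho> by (simp add: h)
  have "1 * 1 \<le> 4 * real d * (real d + 1)" using d by (intro mult_mono) auto
  then have "h \<le> 1" using \<rho> by (simp add: h divide_le_eq)
  then have "1 \<le> 1 / h" using h0 by simp
  moreover have "real m \<le> 6 / h + 1" using h0 unfolding m by simp
  ultimately have "real m \<le> 7 / h" by simp
  also have "7 / h = 28 * real d * (real d + 1) * (1 / \<rho>)" using \<rho> by (simp add: h)
  finally have "real m ^ d \<le> (28 * real d * (real d + 1) * (1 / \<rho>)) ^ d"
    by (intro power_mono) auto
  then have mh: "real m ^ d \<le> (28 * real d * (real d + 1)) ^ d * (1 / \<rho>) ^ d"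
    by (simp only: power_mult_distrib)
  have "m \<le> m ^ d" using d m by (intro self_le_power) auto
  moreover have "4 + d \<le> (4 + d) * m ^ d" using m by simp
  ultimately have "4 + d + m + Suc d * m ^ d \<le> (4 + d) * m ^ d + m ^ d + Suc d * m ^ d" by linarith
  also have "\<dots> = (2 * d + 6) * m ^ d" by (simp add: algebra_simps)
  finally have "real (4 + d + m + Suc d * m ^ d) \<le> (2 * real d + 6) * real m ^ d"
    by (metis (mono_tags, lifting) of_nat_add of_nat_le_iff of_nat_mult of_nat_numeral of_nat_power)
  also have "\<dots> \<le> (2 * real d + 6) * ((28 * real d * (real d + 1)) ^ d * (1 / \<rho>) ^ d)"
    using mh by (intro mult_left_mono) auto
  finally show ?thesis by (simp only: mult.assoc)
qed

theorem theorem7: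
  shows "\<exists>(P :: instr list) (C :: real).
    \<forall>(\<Omega> :: 'a::euclidean_space set) (\<epsilon> :: real).
      polytope \<Omega> \<and> interior \<Omega> \<noteq> {} \<and> \<epsilon> > 0 \<longrightarrow>
      (\<exists>D :: real list.
         real (length D) \<le> C * (1 + 1 / \<epsilon>) powr (real DIM('a) / 2) \<and>
         (\<forall>x \<in> \<Omega>. \<exists>t y. real t \<le> C * ln (2 + 1 / \<epsilon>) \<and>
              halts_with P D x t y \<and>
              \<bar>y - bdist \<Omega> x\<bar> \<le> \<epsilon> * diameter \<Omega>))"
proof -
  define d where "d = DIM('a)"
  have d0: "0 < d" by (simp add: d_def)
  define A where "A = fact (Suc d) * (6 * real d) ^ d"
  define \<kappa> where "\<kappa> = 1 + cut_rate d / 4"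
  define K where "K = (2 * ln A + real d) / ln \<kappa>"
  define a where "a = length (compile d (query_init d)) + length (compile d (query_final d))"
  define b where "b = Suc (length (compile d (query_body d)))"
  define C1 where "C1 = (2 * real d + 6) * (28 * real d * (real d + 1)) ^ d"
  \<comment> \<open>With \<open>W = ln (2 + 1 / \<epsilon>) \<ge> 1/2\<close>, the code outside the
    loop costs \<open>a \<le> 2 * a * W\<close>, and the number of passes is at most
    \<open>K * W + 2 \<le> (K + 4) * W\<close>.\<close>
  define C2 where "C2 = 2 * real a + (K + 4) * real b"
  have A1: "1 \<le> A"
  proof -
    have "1 * 1 \<le> fact (Suc d) * (6 * real d) ^ d"
      using d0 by (intro mult_mono one_le_power) (auto simp: fact_ge_1 simp del: fact_Suc)
    then show ?thesis by (simp add: A_def)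
  qed
  have \<kappa>1: "1 < \<kappa>" by (simp add: \<kappa>_def cut_rate_def add_nonneg_eq_0_iff)
  have K0: "0 \<le> K" using A1 \<kappa>1 by (simp add: K_def)
  have C0: "0 \<le> C1" "0 \<le> C2" using K0 by (simp_all add: C1_def C2_def)
  show ?thesis
  proof (intro exI[of _ "query_program d"] exI[of _ "C1 + C2"] allI impI)
    fix \<Omega> :: "'a set" and \<epsilon> :: real
    assume asm: "polytope \<Omega> \<and> interior \<Omega> \<noteq> {} \<and> \<epsilon> > 0"
    then have \<Omega>: "convex \<Omega>" "compact \<Omega>" "interior \<Omega> \<noteq> {}" and \<epsilon>: "0 < \<epsilon>"
      by (auto simp: polytope_imp_convex polytope_imp_compact)
    define \<Delta> where "\<Delta> = diameter \<Omega>"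
    have \<Delta>0: "0 < \<Delta>"
    proof -
      obtain z r where r: "0 < r" "cball z r \<subseteq> \<Omega>"
        using \<Omega>(3) by (metis all_not_in_conv mem_interior_cball)
      then have "diameter (cball z r) \<le> \<Delta>"
        unfolding \<Delta>_def using compact_imp_bounded[OF \<Omega>(2)] by (intro diameter_subset) auto
      then show ?thesis using r(1) by simp
    qed
    obtain x0 where x0: "x0 \<in> \<Omega>" using \<Omega>(3) interior_subset by blast
    \<comment> \<open>The square of \<rho> is \<epsilon> / (\<epsilon> + 1), which is at most
      \<epsilon> and at most 1, so large \<epsilon> needs no separate treatment; and
      \<open>(1 / \<rho>) ^ d\<close> is exactly the required storage term.\<close>
    define \<rho> where "\<rho> = (1 + 1 / \<epsilon>) powr (- 1 / 2)"
    have base: "1 < 1 + 1 / \<epsilon>" using \<epsilon> by simp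
    have \<rho>: "0 < \<rho>" "\<rho> \<le> 1"
    proof -
      have nz: "1 + 1 / \<epsilon> \<noteq> 0" using base by linarith
      then show "0 < \<rho>" unfolding \<rho>_def by (subst powr_gt_zero)
      show "\<rho> \<le> 1" using powr_mono[of "-1/2" 0 "1 + 1 / \<epsilon>"] base nz unfolding \<rho>_def by simp
    qed
    have \<rho>2: "\<rho>\<^sup>2 \<le> \<epsilon>"
    proof -
      have "\<rho>\<^sup>2 = (1 + 1 / \<epsilon>) powr (- 1)"
        unfolding \<rho>_def power2_eq_square powr_add[symmetric] by simp
      also have "\<dots> = \<epsilon> / (\<epsilon> + 1)" using base \<epsilon> by (simp add: powr_minus field_simps)
      also have "\<dots> \<le> \<epsilon>" using \<epsilon> by (simp add: divide_le_eq)
      finally show ?thesis .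
    qed
    define h where "h = \<rho> / (4 * real d * (real d + 1))"
    define m where "m = nat \<lfloor>6 / h\<rfloor> + 1"
    have m: "6 / h < real m" unfolding m_def by linarith
    define N where "N = nat \<lceil>K * ln (2 + 1 / \<epsilon>)\<rceil>"
    define W where "W = ln (2 + 1 / \<epsilon>)"
    have W: "1/2 \<le> W"
      unfolding W_def using half_le_ln \<epsilon> .
    have N: "A < \<kappa> ^ Suc N * \<rho> ^ d"
      by (rule query_iterations_suffice[OF A1 \<kappa>1 \<epsilon> \<rho>_def])
        (unfold N_def K_def[symmetric], linarith)
    obtain q \<zeta> where model: "\<And>x. x \<in> \<Omega> \<Longrightarrow> \<exists>p'. first_order_model d q \<zeta>
      (coord ((x - x0) /\<^sub>R \<Delta>)) ((norm ((x - x0) /\<^sub>R \<Delta>))\<^sup>2 / 2 - bdist \<Omega> x / \<Delta>) p'"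
      using distance_first_order_model[OF \<Omega> x0 \<Delta>_def \<Delta>0] unfolding d_def by metis
    define D where "D = query_table d N \<Delta> h m (coord x0) q \<zeta>"
    have "real (length D) \<le> C1 * (1 + 1 / \<epsilon>) powr (real d / 2)"
    proof -
      have "(1 / \<rho>) ^ d = (1 + 1 / \<epsilon>) powr (real d / 2)"
      proof -
        have "1 / \<rho> = (1 + 1 / \<epsilon>) powr (1 / 2)" by (simp add: \<rho>_def powr_minus_divide)
        moreover have "((1 + 1 / \<epsilon>) powr (1 / 2)) ^ d = ((1 + 1 / \<epsilon>) powr (1 / 2)) powr real d"
          using \<rho>(1) \<open>1 / \<rho> = _\<close> by (intro powr_realpow[symmetric]) (metis zero_less_divide_1_iff)
        ultimately show ?thesis by (simp add: powr_powr)
      qed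
      then show ?thesis
        using query_table_size[OF d0 \<rho> h_def m_def] by (simp only: D_def length_query_table C1_def)
    qed
    also have "\<dots> \<le> (C1 + C2) * (1 + 1 / \<epsilon>) powr (real DIM('a) / 2)"
      unfolding d_def using C0 by (intro mult_right_mono) auto
    finally have len: "real (length D) \<le> (C1 + C2) * (1 + 1 / \<epsilon>) powr (real DIM('a) / 2)" .
    have time: "real (query_time d N) \<le> (C1 + C2) * W"
    proof -
      have "real N \<le> K * W + 1"
        unfolding N_def W_def[symmetric] using K0 W by (simp add: of_nat_nat)
      then have "real (Suc N) \<le> (K + 4) * W" using W by (simp add: algebra_simps)
      then have "real (Suc N) * real b \<le> (K + 4) * W * real b" by (intro mult_right_mono) auto
      moreover have "real a * 1 \<le> real a * (2 * W)" using W by (intro mult_left_mono) auto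
      moreover have "real (query_time d N) = real a + real (Suc N) * real b"
        unfolding query_time_def a_def b_def by (simp only: of_nat_add of_nat_mult)
      ultimately have "real (query_time d N) \<le> C2 * W"
        unfolding C2_def by (simp add: algebra_simps)
      also have "\<dots> \<le> (C1 + C2) * W" using C0 W by (intro mult_right_mono) auto
      finally show ?thesis .
    qed
    have "\<exists>y. halts_with (query_program d) D x (query_time d N) y \<and> \<bar>y - bdist \<Omega> x\<bar> \<le> \<epsilon> * diameter \<Omega>"
      if x: "x \<in> \<Omega>" for x
    proof -
      define w where "w = (x - x0) /\<^sub>R \<Delta>"
      obtain p' where p': "first_order_model d q \<zeta> (coord w) ((norm w)\<^sup>2 / 2 - bdist \<Omega> x / \<Delta>) p'"
        using model[OF x] unfolding w_def by blast
      have y: "coord w j = (coord x j - coord x0 j) / \<Delta>" for j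
        by (simp add: w_def coord_def inner_diff_left divide_inverse mult.commute)
      have "bdist \<Omega> x / \<Delta> \<le> 1"
        using bdist_le_diameter[OF \<Omega>(2) x \<Omega>(3)] \<Delta>0 by (simp add: \<Delta>_def)
      then have F: "-1 \<le> (norm w)\<^sup>2 / 2 - bdist \<Omega> x / \<Delta>"
        using zero_le_power2[of "norm w"] by linarith
      obtain r where r: "halts_with (query_program d) D x (query_time d N) r"
        "\<bar>r - \<Delta> * ((L2_set (coord w) {..<d})\<^sup>2 / 2 - ((norm w)\<^sup>2 / 2 - bdist \<Omega> x / \<Delta>))\<bar> \<le> \<Delta> * \<rho>\<^sup>2"
        by (rule query_program_halts[OF d_def h_def D_def \<rho> m \<Delta>0 y p' F N[unfolded A_def \<kappa>_def]])
      have "\<Delta> * ((L2_set (coord w) {..<d})\<^sup>2 / 2 - ((norm w)\<^sup>2 / 2 - bdist \<Omega> x / \<Delta>)) = bdist \<Omega> x"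
        using \<Delta>0 by (simp add: d_def flip: norm_eq_L2_set_coord)
      moreover have "\<Delta> * \<rho>\<^sup>2 \<le> \<epsilon> * diameter \<Omega>"
        using mult_left_mono[OF \<rho>2, of \<Delta>] \<Delta>0 by (simp add: \<Delta>_def mult.commute)
      ultimately show ?thesis using r by auto
    qed
    then show "\<exists>D. real (length D) \<le> (C1 + C2) * (1 + 1 / \<epsilon>) powr (real DIM('a) / 2) \<and>
         (\<forall>x \<in> \<Omega>. \<exists>t y. real t \<le> (C1 + C2) * ln (2 + 1 / \<epsilon>) \<and>
              halts_with (query_program d) D x t y \<and>
              \<bar>y - bdist \<Omega> x\<bar> \<le> \<epsilon> * diameter \<Omega>)"
      using len time unfolding W_def by blast
  qed
qed

end
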